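(* Let $T>0$ and $s>3/2$, and let $u\in C([0,T]:H^s(\mathbb{R}))$ be a strong solution of the initial value problem associated to the Camassa-Holm equation in integral-differential form $$\partial_t u+u\,\partial_x u+\partial_x G\ast\Big(u^2+\tfrac12(\partial_x u)^2\Big)=0,\qquad G(x)=\tfrac12 e^{-|x|},$$ with initial datum $u_0(x)=u(x,0)$. Suppose that for some $\alpha\in(1/2,1)$ $$|u_0(x)|= O(e^{-x})\quad\text{and}\quad |\partial_x u_0(x)|= O(e^{-\alpha x})\qquad\text{as } x\to+\infty.$$ Then $$|u(x,t)|= O(e^{-x})\qquad\text{as } x\to+\infty,$$ uniformly in $t\in[0,T]$ (i.e. there are constants $C,X>0$ such that $|u(x,t)|\le Ce^{-x}$ for all $x\ge X$ and all $t\in[0,T]$).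
   Context: Functions are real-valued, $\ast$ denotes convolution in $x\in\mathbb{R}$, and $H^s(\mathbb{R})$ is the usual $L^2$-based Sobolev space. A strong solution on $[0,T]$ is a function $u\in C([0,T]:H^s(\mathbb{R}))\cap C^1([0,T]:H^{s-1}(\mathbb{R}))$ satisfying the equation for every $t\in[0,T]$ as an identity in $H^{s-1}(\mathbb{R})$. Since $s>3/2$, $u(\cdot,t)$ and $\partial_x u(\cdot,t)$ are continuous bounded functions, so pointwise statements make sense. The equation is the integral-differential form of the Camassa-Holm equation $\partial_t u-\partial_t\partial_x^2u+3u\partial_xu-2\partial_xu\,\partial_x^2u-u\,\partial_x^3u=0$, obtained by inverting $1-\partial_x^2$, whose fundamental solution is $\tfrac12e^{-|x|}$. *)

theory Defs
  imports "HOL-Analysis.Analysis" "HOL-Library.Landau_Symbols"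
begin

definition square_integrable :: "(real \<Rightarrow> 'a::{banach, second_countable_topology}) \<Rightarrow> bool" where
  "square_integrable f \<longleftrightarrow>
     f \<in> borel_measurable lborel \<and> integrable lborel (\<lambda>x. (norm (f x))\<^sup>2)"

(* Fourier transform on L^2 in Plancherel's form: g is the L^2 limit, as R tends to infinity, of
   the integrals of exp(-i x \<xi>) f(x) over [-R,R].  For square integrable f such a g exists and is
   unique up to null sets.  The mean square distance is taken as a nonnegative extended integral,
   so the limit cannot hold merely because an integrand fails to be integrable. *)
definition has_fourier_transform :: "(real \<Rightarrow> real) \<Rightarrow> (real \<Rightarrow> complex) \<Rightarrow> bool" where
  "has_fourier_transform f g \<longleftrightarrow>
     square_integrable f \<and> square_integrable g \<and>
     ((\<lambda>R. \<integral>\<^sup>+ \<xi>. ennreal ((cmod ((LINT x:{-R..R}|lborel. cis (- (x * \<xi>)) * of_real (f x)) - g \<xi>))\<^sup>2)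
          \<partial>lborel) \<longlongrightarrow> 0) at_top"

definition fourier_transform :: "(real \<Rightarrow> real) \<Rightarrow> real \<Rightarrow> complex" where
  "fourier_transform f = (SOME g. has_fourier_transform f g)"

(* H^s of the real line for s \<ge> 0, where it is a subspace of L^2.  Elements are represented by
   functions; functions equal almost everywhere represent the same element. *)
definition sobolev :: "real \<Rightarrow> (real \<Rightarrow> real) set" where
  "sobolev s = {f. \<exists>g. has_fourier_transform f g \<and>
                      integrable lborel (\<lambda>\<xi>. (1 + \<xi>\<^sup>2) powr s * (cmod (g \<xi>))\<^sup>2)}"

definition sobolev_norm :: "real \<Rightarrow> (real \<Rightarrow> real) \<Rightarrow> real" where
  "sobolev_norm s f =
     sqrt (LINT \<xi>|lborel. (1 + \<xi>\<^sup>2) powr s * (cmod (fourier_transform f \<xi>))\<^sup>2)"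

(* Curves in a function space are written t \<mapsto> w t, so that w t x stands for w(x,t). *)
definition sobolev_continuous_on :: "real \<Rightarrow> real set \<Rightarrow> (real \<Rightarrow> real \<Rightarrow> real) \<Rightarrow> bool" where
  "sobolev_continuous_on s I w \<longleftrightarrow>
     (\<forall>t\<in>I. w t \<in> sobolev s) \<and>
     (\<forall>t\<in>I. ((\<lambda>\<tau>. sobolev_norm s (\<lambda>x. w \<tau> x - w t x)) \<longlongrightarrow> 0) (at t within I))"

definition has_sobolev_derivative_on ::
  "real \<Rightarrow> real set \<Rightarrow> (real \<Rightarrow> real \<Rightarrow> real) \<Rightarrow> (real \<Rightarrow> real \<Rightarrow> real) \<Rightarrow> bool" where
  "has_sobolev_derivative_on s I w v \<longleftrightarrow>
     (\<forall>t\<in>I. w t \<in> sobolev s \<and> v t \<in> sobolev s \<and>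
        ((\<lambda>\<tau>. sobolev_norm s (\<lambda>x. (w \<tau> x - w t x) / (\<tau> - t) - v t x)) \<longlongrightarrow> 0) (at t within I))"

definition convolution :: "(real \<Rightarrow> real) \<Rightarrow> (real \<Rightarrow> real) \<Rightarrow> real \<Rightarrow> real" where
  "convolution f g x = (LINT y|lborel. f (x - y) * g y)"

definition G :: "real \<Rightarrow> real" where
  "G x = 1/2 * exp (- \<bar>x\<bar>)"

(* u t is the continuous representative of its class, hence continuously differentiable when
   s > 3/2, so deriv (u t) is its classical derivative.  The function v is the time derivative of u
   with values in H^(s-1), and the equation is an equality of classes, i.e. almost everywhere in x.
   G is Lipschitz and not differentiable only at 0, so deriv G represents its weak derivative. *)
definition CH_strong_solution :: "real \<Rightarrow> real \<Rightarrow> (real \<Rightarrow> real \<Rightarrow> real) \<Rightarrow> bool" where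
  "CH_strong_solution s T u \<longleftrightarrow>
     sobolev_continuous_on s {0..T} u \<and>
     (\<forall>t\<in>{0..T}. continuous_on UNIV (u t)) \<and>
     (\<exists>v. has_sobolev_derivative_on (s - 1) {0..T} u v \<and>
          sobolev_continuous_on (s - 1) {0..T} v \<and>
          (\<forall>t\<in>{0..T}. AE x in lborel.
             v t x + u t x * deriv (u t) x
               + convolution (deriv G) (\<lambda>y. (u t y)\<^sup>2 + 1/2 * (deriv (u t) y)\<^sup>2) x = 0))"

end

theory Submission
  imports Defs "HOL-Probability.Characteristic_Functions"
begin

text \<open>
  The proof runs along the transport structure of the equation. Write $P = G' * (u^2 + u_x^2/2)$, so
  that $u_t + u u_x = - P$. A weight that is nearly constant along the flow turns exponential decay
  into a maximum principle: if $\omega > 0$ satisfies $|\omega'| \le \omega$ and tends to infinity at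
  both ends, then $|w| e^{-Kt} / \omega$ attains its maximum for every bounded continuous $w$, and at
  a maximum with $t > 0$ and $w > 0$ one has $w_t \ge K w$ and $w_x = w \omega' / \omega$. For large $K$ an
  equation $w_t + a w_x = O(|w|) + \mathit{source}$ with bounded $a$ then bounds $|w|$ by the source
  and the initial data (\<open>transport_maximum_principle\<close>). The weights are
  $\omega(x) = e^{-\theta x} + \delta e^{\theta x}$; the second term makes the maximum exist, and
  letting $\delta$ tend to $0$ leaves decay at the rate $\theta$. Characteristics, which would need
  the solution theory of an ordinary differential equation, are avoided in this way.

  For $\theta = \alpha < 1$ convolution with $e^{-|x|}$ preserves the weight up to a constant, and
  the source is quadratic with bounded factors, so $P$ is bounded by a multiple of $B \omega$ as soon
  as $|u|$ and $|u_x|$ are bounded by $B \omega$. The same principle is applied to $u$ and to the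
  difference quotients $(u(x+h) - u(x))/h$; the latter replace $u_x$, for which $u_{xx}$ need
  not be a function. With $K$ large the bound $B$ improves to the maximum of the initial constant and
  $B/2$ (\<open>weighted_bound_improves\<close>); iteration removes the a priori constant, which depends on
  $\delta$, and gives decay of $u$ and $u_x$ at rate $\alpha$ (\<open>decay_below_one\<close>).

  Since $2\alpha > 1$, the quadratic source now decays faster than $e^{-x}$, and the convolution $P$
  inherits the decay $e^{-x}$ of its kernel (\<open>nonlocal_decay\<close>). Now $P$ is a known source of the right size,
  so the maximum principle with $\theta = 1$ gives the theorem.

  All this is pointwise, whereas a strong solution satisfies the equation between classes in $H^{s-1}$.
  Fourier inversion for continuous functions with integrable transform (\<open>fourier_inversion\<close>) yields
  the embeddings \<open>sobolev_C0\<close> and \<open>sobolev_C1\<close>; as $s - 1 > 1/2$, the difference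
  quotients in time converge uniformly in $x$, and the equation holds at every point
  (\<open>strong_solution_time_derivative\<close>).
\<close>

section \<open>The Fourier transform on square integrable functions\<close>

text \<open>
  If $f$ is not integrable its integral is $0$ by convention, and the integral of $g$ is nonnegative.
\<close>
lemma integral_norm_bound_AE:
  fixes f :: "'a \<Rightarrow> 'b::{banach, second_countable_topology}"
  assumes "integrable M g" "AE x in M. norm (f x) \<le> g x"
  shows "norm (\<integral>x. f x \<partial>M) \<le> (\<integral>x. g x \<partial>M)"
proof (cases "integrable M f")
  case True
  then show ?thesis
    using integral_norm_bound[of M f] integral_mono_AE[OF integrable_norm[OF True] assms] by linarith
next
  case False
  have "AE x in M. 0 \<le> g x" using assms(2) by eventually_elim (meson norm_ge_zero order_trans)
  then show ?thesis using False integral_nonneg_AE[of g M] by (simp add: not_integrable_integral_eq)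
qed

definition truncated_fourier :: "real \<Rightarrow> (real \<Rightarrow> real) \<Rightarrow> real \<Rightarrow> complex" where
  "truncated_fourier R f \<xi> = (LINT x:{-R..R}|lborel. cis (- (x * \<xi>)) * of_real (f x))"

text \<open>
  On a bounded interval $|f| \le 1 + |f|^2$ is integrable.
\<close>
lemma square_integrable_set_integrable:
  fixes f :: "real \<Rightarrow> 'a :: {banach, second_countable_topology}"
  assumes "square_integrable f"
  shows "set_integrable lborel {-R..R} f"
  unfolding set_integrable_def
proof (rule Bochner_Integration.integrable_bound)
  have [measurable]: "f \<in> borel_measurable borel"
    using assms by (simp add: square_integrable_def)
  show "integrable lborel (\<lambda>x. indicat_real {-R..R} x + (norm (f x))\<^sup>2)"
    using assms by (auto simp: square_integrable_def emeasure_lborel_Icc_eq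
        intro!: Bochner_Integration.integrable_add integrable_real_indicator)
  show "AE x in lborel. norm (indicat_real {-R..R} x *\<^sub>R f x)
      \<le> norm (indicat_real {-R..R} x + (norm (f x))\<^sup>2)"
  proof (rule AE_I2)
    fix x
    have "norm (f x) \<le> 1 + (norm (f x))\<^sup>2"
      using zero_le_power2[of "norm (f x) - 1 / 2"] by (simp add: power2_eq_square algebra_simps)
    then show "norm (indicat_real {-R..R} x *\<^sub>R f x)
        \<le> norm (indicat_real {-R..R} x + (norm (f x))\<^sup>2)"
      by (auto simp: indicator_def)
  qed
  show "(\<lambda>x. indicat_real {-R..R} x *\<^sub>R f x) \<in> borel_measurable lborel" by measurable
qed

lemma borel_measurable_cis [measurable]: "cis \<in> borel_measurable borel"
  by (intro borel_measurable_continuous_onI continuous_intros)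

lemma truncated_fourier_integrable:
  fixes f :: "real \<Rightarrow> real"
  assumes "square_integrable f"
  shows "set_integrable lborel {-R..R} (\<lambda>x. cis (- (x * \<xi>)) * of_real (f x))"
  unfolding set_integrable_def
proof (rule Bochner_Integration.integrable_bound)
  have [measurable]: "f \<in> borel_measurable borel"
    using assms by (simp add: square_integrable_def)
  show "integrable lborel (\<lambda>x. indicat_real {-R..R} x *\<^sub>R f x)"
    using square_integrable_set_integrable[OF assms] by (simp add: set_integrable_def)
  show "(\<lambda>x. indicat_real {-R..R} x *\<^sub>R (cis (- (x * \<xi>)) * of_real (f x))) \<in> borel_measurable lborel"
    by measurable
qed (auto simp: norm_mult)

lemma truncated_fourier_measurable [measurable]:
  fixes f :: "real \<Rightarrow> real"
  assumes [measurable]: "f \<in> borel_measurable borel"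
  shows "truncated_fourier R f \<in> borel_measurable borel"
  unfolding truncated_fourier_def[abs_def] set_lebesgue_integral_def by measurable

lemma has_fourier_transformD:
  assumes "has_fourier_transform f g"
  shows "square_integrable f" "square_integrable g"
    "f \<in> borel_measurable borel" "g \<in> borel_measurable borel"
    "((\<lambda>R. \<integral>\<^sup>+ \<xi>. ennreal ((cmod (truncated_fourier R f \<xi> - g \<xi>))\<^sup>2) \<partial>lborel) \<longlongrightarrow> 0) at_top"
  using assms by (auto simp: has_fourier_transform_def square_integrable_def truncated_fourier_def)

lemma power2_norm_add_le: 
  fixes a b :: "'a::real_normed_vector"
  shows "(norm (a + b))\<^sup>2 \<le> 2 * (norm a)\<^sup>2 + 2 * (norm b)\<^sup>2"
proof -
  have "(norm (a + b))\<^sup>2 \<le> (norm a + norm b)\<^sup>2"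
    by (intro power_mono norm_triangle_ineq) simp
  also have "\<dots> \<le> 2 * (norm a)\<^sup>2 + 2 * (norm b)\<^sup>2"
    using zero_le_power2[of "norm a - norm b"] by (simp add: power2_eq_square algebra_simps)
  finally show ?thesis .
qed

lemma nn_integral_power2_norm_add_le:
  fixes f g :: "'a \<Rightarrow> 'b::{real_normed_vector, second_countable_topology}"
  assumes [measurable]: "f \<in> borel_measurable M" "g \<in> borel_measurable M"
  shows "(\<integral>\<^sup>+ x. ennreal ((norm (f x + g x))\<^sup>2) \<partial>M)
    \<le> 2 * (\<integral>\<^sup>+ x. ennreal ((norm (f x))\<^sup>2) \<partial>M) + 2 * (\<integral>\<^sup>+ x. ennreal ((norm (g x))\<^sup>2) \<partial>M)"
proof -
  have "(\<integral>\<^sup>+ x. ennreal ((norm (f x + g x))\<^sup>2) \<partial>M)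
      \<le> (\<integral>\<^sup>+ x. 2 * ennreal ((norm (f x))\<^sup>2) + 2 * ennreal ((norm (g x))\<^sup>2) \<partial>M)"
  proof (rule nn_integral_mono)
    fix x
    have "ennreal ((norm (f x + g x))\<^sup>2) \<le> ennreal (2 * (norm (f x))\<^sup>2 + 2 * (norm (g x))\<^sup>2)"
      by (intro ennreal_leI power2_norm_add_le)
    then show "ennreal ((norm (f x + g x))\<^sup>2) \<le> 2 * ennreal ((norm (f x))\<^sup>2) + 2 * ennreal ((norm (g x))\<^sup>2)"
      by (simp add: ennreal_plus ennreal_mult)
  qed
  also have "\<dots> = 2 * (\<integral>\<^sup>+ x. ennreal ((norm (f x))\<^sup>2) \<partial>M) + 2 * (\<integral>\<^sup>+ x. ennreal ((norm (g x))\<^sup>2) \<partial>M)"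
    by (simp add: nn_integral_add nn_integral_cmult)
  finally show ?thesis .
qed

lemma square_integrable_add:
  fixes f g :: "real \<Rightarrow> 'a :: {banach, second_countable_topology}"
  assumes "square_integrable f" "square_integrable g"
  shows "square_integrable (\<lambda>x. f x + g x)"
proof -
  have [measurable]: "f \<in> borel_measurable borel" "g \<in> borel_measurable borel"
    using assms by (simp_all add: square_integrable_def)
  have "integrable lborel (\<lambda>x. (norm (f x + g x))\<^sup>2)"
  proof (rule Bochner_Integration.integrable_bound)
    show "integrable lborel (\<lambda>x. 2 * (norm (f x))\<^sup>2 + 2 * (norm (g x))\<^sup>2)"
      using assms by (auto simp: square_integrable_def)
    show "AE x in lborel. norm ((norm (f x + g x))\<^sup>2) \<le> norm (2 * (norm (f x))\<^sup>2 + 2 * (norm (g x))\<^sup>2)"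
      using power2_norm_add_le[of "f _" "g _"] by (auto intro!: AE_I2)
  qed measurable
  then show ?thesis by (simp add: square_integrable_def)
qed

lemma square_integrable_scaleR:
  fixes f :: "real \<Rightarrow> 'a :: {banach, second_countable_topology}"
  assumes "square_integrable f"
  shows "square_integrable (\<lambda>x. c *\<^sub>R f x)"
  using assms by (auto simp: square_integrable_def power_mult_distrib)

lemma has_fourier_transform_add:
  assumes "has_fourier_transform f g" "has_fourier_transform f' g'"
  shows "has_fourier_transform (\<lambda>x. f x + f' x) (\<lambda>\<xi>. g \<xi> + g' \<xi>)"
proof -
  note D = has_fourier_transformD[OF assms(1)] and D' = has_fourier_transformD[OF assms(2)]
  note [measurable] = D(3,4) D'(3,4)
  have trunc: "truncated_fourier R (\<lambda>x. f x + f' x) \<xi> = truncated_fourier R f \<xi> + truncated_fourier R f' \<xi>" for R \<xi>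
    unfolding truncated_fourier_def
    by (subst set_integral_add(2)[symmetric])
       (auto intro!: truncated_fourier_integrable D D' simp: distrib_left)
  let ?I = "\<lambda>h R. \<integral>\<^sup>+ \<xi>. ennreal ((cmod (h R \<xi>))\<^sup>2) \<partial>lborel"
  have "((\<lambda>R. 2 * ?I (\<lambda>R \<xi>. truncated_fourier R f \<xi> - g \<xi>) R + 2 * ?I (\<lambda>R \<xi>. truncated_fourier R f' \<xi> - g' \<xi>) R) \<longlongrightarrow> 2 * 0 + 2 * 0) at_top"
    by (intro tendsto_add tendsto_mult_ennreal tendsto_const D D') auto
  then have lim: "((\<lambda>R. 2 * ?I (\<lambda>R \<xi>. truncated_fourier R f \<xi> - g \<xi>) R + 2 * ?I (\<lambda>R \<xi>. truncated_fourier R f' \<xi> - g' \<xi>) R) \<longlongrightarrow> 0) at_top"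
    by simp
  have "((\<lambda>R. ?I (\<lambda>R \<xi>. truncated_fourier R (\<lambda>x. f x + f' x) \<xi> - (g \<xi> + g' \<xi>)) R) \<longlongrightarrow> 0) at_top"
  proof (rule tendsto_sandwich[OF _ _ tendsto_const lim])
    show "\<forall>\<^sub>F R in at_top. ?I (\<lambda>R \<xi>. truncated_fourier R (\<lambda>x. f x + f' x) \<xi> - (g \<xi> + g' \<xi>)) R
      \<le> 2 * ?I (\<lambda>R \<xi>. truncated_fourier R f \<xi> - g \<xi>) R + 2 * ?I (\<lambda>R \<xi>. truncated_fourier R f' \<xi> - g' \<xi>) R"
    proof (intro always_eventually allI)
      fix R
      have "truncated_fourier R (\<lambda>x. f x + f' x) \<xi> - (g \<xi> + g' \<xi>)
          = (truncated_fourier R f \<xi> - g \<xi>) + (truncated_fourier R f' \<xi> - g' \<xi>)" for \<xi>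
        unfolding trunc by simp
      then show "?I (\<lambda>R \<xi>. truncated_fourier R (\<lambda>x. f x + f' x) \<xi> - (g \<xi> + g' \<xi>)) R
        \<le> 2 * ?I (\<lambda>R \<xi>. truncated_fourier R f \<xi> - g \<xi>) R + 2 * ?I (\<lambda>R \<xi>. truncated_fourier R f' \<xi> - g' \<xi>) R"
        by (simp only:) (rule nn_integral_power2_norm_add_le; measurable)
    qed
  qed simp
  then show ?thesis
    unfolding has_fourier_transform_def truncated_fourier_def[symmetric]
    by (intro conjI square_integrable_add D(1,2) D'(1,2))
qed

lemma has_fourier_transform_scale:
  assumes "has_fourier_transform f g"
  shows "has_fourier_transform (\<lambda>x. c * f x) (\<lambda>\<xi>. of_real c * g \<xi>)"
proof -
  note D = has_fourier_transformD[OF assms(1)]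
  note [measurable] = D(3,4)
  have trunc: "truncated_fourier R (\<lambda>x. c * f x) \<xi> = of_real c * truncated_fourier R f \<xi>" for R \<xi>
    unfolding truncated_fourier_def
    by (subst set_integral_mult_right[symmetric]) (simp add: algebra_simps)
  let ?I = "\<lambda>h R. \<integral>\<^sup>+ \<xi>. ennreal ((cmod (h R \<xi>))\<^sup>2) \<partial>lborel"
  have "?I (\<lambda>R \<xi>. truncated_fourier R (\<lambda>x. c * f x) \<xi> - of_real c * g \<xi>) R
      = ennreal (c\<^sup>2) * ?I (\<lambda>R \<xi>. truncated_fourier R f \<xi> - g \<xi>) R" for R
    by (simp add: trunc right_diff_distrib[symmetric] norm_mult power_mult_distrib ennreal_mult nn_integral_cmult)
  moreover have "((\<lambda>R. ennreal (c\<^sup>2) * ?I (\<lambda>R \<xi>. truncated_fourier R f \<xi> - g \<xi>) R) \<longlongrightarrow> ennreal (c\<^sup>2) * 0) at_top"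
    by (intro tendsto_mult_ennreal tendsto_const D) auto
  ultimately show ?thesis
    unfolding has_fourier_transform_def truncated_fourier_def[symmetric]
    using square_integrable_scaleR[OF D(1), of c] square_integrable_scaleR[OF D(2), of c]
    by (simp add: scaleR_conv_of_real)
qed

text \<open>
  Both candidates are limits in mean square of the same truncated transforms.  Hence the transform
  chosen by the Hilbert operator agrees almost everywhere with any other one.
\<close>
lemma has_fourier_transform_unique:
  assumes "has_fourier_transform f g" "has_fourier_transform f h"
  shows "AE \<xi> in lborel. g \<xi> = h \<xi>"
proof -
  note D = has_fourier_transformD[OF assms(1)] and D' = has_fourier_transformD[OF assms(2)]
  note [measurable] = D(3,4) D'(4)
  let ?I = "\<lambda>h R. \<integral>\<^sup>+ \<xi>. ennreal ((cmod (h R \<xi>))\<^sup>2) \<partial>lborel"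
  have "((\<lambda>R. 2 * ?I (\<lambda>R \<xi>. truncated_fourier R f \<xi> - g \<xi>) R + 2 * ?I (\<lambda>R \<xi>. truncated_fourier R f \<xi> - h \<xi>) R) \<longlongrightarrow> 2 * 0 + 2 * 0) at_top"
    by (intro tendsto_add tendsto_mult_ennreal tendsto_const D D') auto
  moreover have "(\<integral>\<^sup>+ \<xi>. ennreal ((cmod (g \<xi> - h \<xi>))\<^sup>2) \<partial>lborel)
      \<le> 2 * ?I (\<lambda>R \<xi>. truncated_fourier R f \<xi> - g \<xi>) R + 2 * ?I (\<lambda>R \<xi>. truncated_fourier R f \<xi> - h \<xi>) R" for R
    using nn_integral_power2_norm_add_le[of "\<lambda>\<xi>. g \<xi> - truncated_fourier R f \<xi>" lborel "\<lambda>\<xi>. truncated_fourier R f \<xi> - h \<xi>"]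
    by (simp add: norm_minus_commute)
  ultimately have "(\<integral>\<^sup>+ \<xi>. ennreal ((cmod (g \<xi> - h \<xi>))\<^sup>2) \<partial>lborel) \<le> 0"
    by (intro tendsto_lowerbound[of _ "0::ennreal" "at_top :: real filter"]) auto
  then have "AE \<xi> in lborel. ennreal ((cmod (g \<xi> - h \<xi>))\<^sup>2) = 0"
    by (subst nn_integral_0_iff_AE[symmetric]) auto
  then show ?thesis by eventually_elim (simp add: ennreal_eq_0_iff)
qed

text \<open>
  The predicate sees only the class of $f$; this allows the time derivative, known only almost
  everywhere, to be exchanged for a continuous representative.
\<close>
lemma has_fourier_transform_cong_AE:
  assumes "AE x in lborel. f x = f' x" "f' \<in> borel_measurable borel"
    and "has_fourier_transform f g"
  shows "has_fourier_transform f' g"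
proof -
  note D = has_fourier_transformD[OF assms(3)]
  note [measurable] = D(3,4) assms(2)
  have "truncated_fourier R f' \<xi> = truncated_fourier R f \<xi>" for R \<xi>
    unfolding truncated_fourier_def set_lebesgue_integral_def using assms(1)
    by (intro integral_cong_AE) auto
  moreover have "square_integrable f'"
  proof -
    have "integrable lborel (\<lambda>x. (norm (f' x))\<^sup>2)"
      using D(1) assms(1) unfolding square_integrable_def
      by (subst integrable_cong_AE[of _ _ "\<lambda>x. (norm (f x))\<^sup>2"]) auto
    then show ?thesis by (simp add: square_integrable_def)
  qed
  ultimately show ?thesis
    using assms(3) unfolding has_fourier_transform_def truncated_fourier_def[symmetric] by simp
qed

lemma sobolevI:
  "has_fourier_transform f g \<Longrightarrow> integrable lborel (\<lambda>\<xi>. (1 + \<xi>\<^sup>2) powr s * (cmod (g \<xi>))\<^sup>2)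
    \<Longrightarrow> f \<in> sobolev s"
  unfolding sobolev_def by blast

lemma sobolev_fourier_transform:
  assumes "f \<in> sobolev s"
  shows "has_fourier_transform f (fourier_transform f)"
    and "integrable lborel (\<lambda>\<xi>. (1 + \<xi>\<^sup>2) powr s * (cmod (fourier_transform f \<xi>))\<^sup>2)"
proof -
  from assms obtain g where g: "has_fourier_transform f g"
    and int: "integrable lborel (\<lambda>\<xi>. (1 + \<xi>\<^sup>2) powr s * (cmod (g \<xi>))\<^sup>2)"
    by (auto simp: sobolev_def)
  show *: "has_fourier_transform f (fourier_transform f)"
    unfolding fourier_transform_def by (rule someI[of "has_fourier_transform f", OF g])
  note [measurable] = has_fourier_transformD(4)[OF *] has_fourier_transformD(4)[OF g]
  show "integrable lborel (\<lambda>\<xi>. (1 + \<xi>\<^sup>2) powr s * (cmod (fourier_transform f \<xi>))\<^sup>2)"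
    using int has_fourier_transform_unique[OF g *]
    by (subst integrable_cong_AE[of _ _ "\<lambda>\<xi>. (1 + \<xi>\<^sup>2) powr s * (cmod (g \<xi>))\<^sup>2"]) auto
qed

lemma sobolev_add:
  assumes "f \<in> sobolev s" "f' \<in> sobolev s"
  shows "(\<lambda>x. f x + f' x) \<in> sobolev s"
proof -
  let ?g = "fourier_transform f" and ?g' = "fourier_transform f'"
  note S = sobolev_fourier_transform[OF assms(1)] and S' = sobolev_fourier_transform[OF assms(2)]
  note [measurable] = has_fourier_transformD(4)[OF S(1)] has_fourier_transformD(4)[OF S'(1)]
  have "integrable lborel (\<lambda>\<xi>. (1 + \<xi>\<^sup>2) powr s * (cmod (?g \<xi> + ?g' \<xi>))\<^sup>2)"
  proof (rule Bochner_Integration.integrable_bound)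
    show "integrable lborel (\<lambda>\<xi>. 2 * ((1 + \<xi>\<^sup>2) powr s * (cmod (?g \<xi>))\<^sup>2)
        + 2 * ((1 + \<xi>\<^sup>2) powr s * (cmod (?g' \<xi>))\<^sup>2))"
      by (intro Bochner_Integration.integrable_add integrable_mult_right S(2) S'(2))
    show "AE \<xi> in lborel. norm ((1 + \<xi>\<^sup>2) powr s * (cmod (?g \<xi> + ?g' \<xi>))\<^sup>2)
      \<le> norm (2 * ((1 + \<xi>\<^sup>2) powr s * (cmod (?g \<xi>))\<^sup>2) + 2 * ((1 + \<xi>\<^sup>2) powr s * (cmod (?g' \<xi>))\<^sup>2))"
    proof (rule AE_I2)
      fix \<xi> :: real
      have "(1 + \<xi>\<^sup>2) powr s * (cmod (?g \<xi> + ?g' \<xi>))\<^sup>2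
          \<le> (1 + \<xi>\<^sup>2) powr s * (2 * (cmod (?g \<xi>))\<^sup>2 + 2 * (cmod (?g' \<xi>))\<^sup>2)"
        by (intro mult_left_mono power2_norm_add_le) simp
      also have "\<dots> = 2 * ((1 + \<xi>\<^sup>2) powr s * (cmod (?g \<xi>))\<^sup>2) + 2 * ((1 + \<xi>\<^sup>2) powr s * (cmod (?g' \<xi>))\<^sup>2)"
        by algebra
      finally show "norm ((1 + \<xi>\<^sup>2) powr s * (cmod (?g \<xi> + ?g' \<xi>))\<^sup>2)
        \<le> norm (2 * ((1 + \<xi>\<^sup>2) powr s * (cmod (?g \<xi>))\<^sup>2) + 2 * ((1 + \<xi>\<^sup>2) powr s * (cmod (?g' \<xi>))\<^sup>2))"
        by simp
    qed
    show "(\<lambda>\<xi>. (1 + \<xi>\<^sup>2) powr s * (cmod (?g \<xi> + ?g' \<xi>))\<^sup>2) \<in> borel_measurable lborel"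
      by simp
  qed
  then show ?thesis by (rule sobolevI[OF has_fourier_transform_add[OF S(1) S'(1)]])
qed

lemma sobolev_scale:
  assumes "f \<in> sobolev s"
  shows "(\<lambda>x. c * f x) \<in> sobolev s"
proof -
  note S = sobolev_fourier_transform[OF assms]
  have "integrable lborel (\<lambda>\<xi>. c\<^sup>2 * ((1 + \<xi>\<^sup>2) powr s * (cmod (fourier_transform f \<xi>))\<^sup>2))"
    by (intro integrable_mult_right S(2))
  then have "integrable lborel (\<lambda>\<xi>. (1 + \<xi>\<^sup>2) powr s * (cmod (of_real c * fourier_transform f \<xi>))\<^sup>2)"
    by (simp add: norm_mult power_mult_distrib mult_ac)
  then show ?thesis by (rule sobolevI[OF has_fourier_transform_scale[OF S(1)]])
qed

lemma sobolev_diff: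
  assumes "f \<in> sobolev s" "f' \<in> sobolev s"
  shows "(\<lambda>x. f x - f' x) \<in> sobolev s"
  using sobolev_add[OF assms(1) sobolev_scale[OF assms(2), of "-1"]] by simp

text \<open>
  The norm is unchanged because $f$ and $f'$ have literally the same set of transforms, from which the
  same one is chosen.
\<close>
lemma sobolev_cong_AE:
  assumes "f \<in> sobolev s" "AE x in lborel. f x = f' x" "f' \<in> borel_measurable borel"
  shows "f' \<in> sobolev s" "sobolev_norm r f' = sobolev_norm r f"
proof -
  have [measurable]: "f \<in> borel_measurable borel"
    using sobolev_fourier_transform(1)[OF assms(1)] by (rule has_fourier_transformD)
  have "AE x in lborel. f' x = f x" using assms(2) by eventually_elim simp
  then have "has_fourier_transform f' = has_fourier_transform f"
    by (intro ext iffI) (erule has_fourier_transform_cong_AE[rotated 2]; use assms in simp)+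
  then show "f' \<in> sobolev s" "sobolev_norm r f' = sobolev_norm r f"
    using assms(1) unfolding sobolev_def sobolev_norm_def fourier_transform_def by simp_all
qed

section \<open>Fourier inversion at points of continuity\<close>

text \<open>
  Even functions are integrated by reflecting the half line; the origin is a null set.
\<close>
lemma has_bochner_integral_abs:
  fixes f :: "real \<Rightarrow> real"
  assumes "has_bochner_integral lborel (\<lambda>y. indicator {0..} y * f y) I"
  shows "has_bochner_integral lborel (\<lambda>y. f \<bar>y\<bar>) (2 * I)"
proof -
  have refl: "has_bochner_integral lborel (\<lambda>y. indicator {0..} (- y) * f (- y)) I"
    using lborel_has_bochner_integral_real_affine_iff[of "-1" "\<lambda>y. indicator {0..} y * f y" I 0] assms
    by simp
  note sum = has_bochner_integral_add[OF assms refl]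
  have meas: "(\<lambda>y. f \<bar>y\<bar>) \<in> borel_measurable lborel"
  proof -
    have [measurable]: "(\<lambda>y. indicator {0..} y * f y) \<in> borel_measurable borel"
      using borel_measurable_has_bochner_integral[OF assms] by simp
    have "(\<lambda>y. indicator {0..} \<bar>y\<bar> * f \<bar>y\<bar>) \<in> borel_measurable borel"
      by (rule measurable_compose[of abs borel borel "\<lambda>y. indicator {0..} y * f y"]) auto
    then show ?thesis by simp
  qed
  have "AE y in lborel. y \<noteq> (0::real)" by (rule AE_lborel_singleton)
  then have "AE y in lborel. indicator {0..} y * f y + indicator {0..} (- y) * f (- y) = f \<bar>y\<bar>"
    by eventually_elim (auto simp: indicator_def)
  then have "has_bochner_integral lborel (\<lambda>y. f \<bar>y\<bar>) (I + I)"
    using has_bochner_integral_cong_AE[OF _ meas, THEN iffD1, OF _ _ sum]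
      borel_measurable_has_bochner_integral[OF sum] by blast
  then show ?thesis by simp
qed

text \<open>
  The characteristic function of the standard normal distribution, rescaled.
\<close>
lemma gaussian_fourier_integral:
  assumes "0 < n"
  shows "has_bochner_integral lborel (\<lambda>\<xi>. cis (b * \<xi>) * of_real (exp (- (\<xi> / n)\<^sup>2 / 2)))
           (of_real (n * sqrt (2 * pi) * exp (- (b * n)\<^sup>2 / 2)))"
proof -
  let ?e = "\<lambda>z::real. exp (- z\<^sup>2 / 2)"
  have dens: "?e z = sqrt (2 * pi) * std_normal_density z" for z
    by (simp add: std_normal_density_def)
  have int: "integrable lborel (\<lambda>z. std_normal_density z *\<^sub>R cis (b * n * z))"
  proof (rule Bochner_Integration.integrable_bound)
    show "integrable lborel std_normal_density" by simp
    show "(\<lambda>z. std_normal_density z *\<^sub>R cis (b * n * z)) \<in> borel_measurable lborel" by measurable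
  qed auto
  have "(LINT z|lborel. std_normal_density z *\<^sub>R cis (b * n * z)) = char std_normal_distribution (b * n)"
    unfolding char_def by (subst integral_density) (auto simp: cis_conv_exp mult_ac)
  also have "\<dots> = of_real (?e (b * n))" by (simp add: char_std_normal_distribution)
  finally have "has_bochner_integral lborel (\<lambda>z. std_normal_density z *\<^sub>R cis (b * n * z)) (of_real (?e (b * n)))"
    using int by (simp add: has_bochner_integral_iff)
  then have "has_bochner_integral lborel (\<lambda>z. of_real (sqrt (2 * pi)) * (std_normal_density z *\<^sub>R cis (b * n * z)))
      (of_real (sqrt (2 * pi)) * of_real (?e (b * n)))"
    by (rule has_bochner_integral_mult_right)
  moreover have "(\<lambda>z. complex_of_real (sqrt (2 * pi)) * (std_normal_density z *\<^sub>R cis (b * n * z)))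
      = (\<lambda>z. cis (b * (0 + n * z)) * of_real (?e ((0 + n * z) / n)))"
  proof
    fix z
    have "(0 + n * z) / n = z" "b * (0 + n * z) = b * n * z" using assms by simp_all
    then show "complex_of_real (sqrt (2 * pi)) * (std_normal_density z *\<^sub>R cis (b * n * z))
        = cis (b * (0 + n * z)) * of_real (?e ((0 + n * z) / n))"
      by (simp only: dens of_real_mult scaleR_conv_of_real mult_ac)
  qed
  moreover have "complex_of_real (sqrt (2 * pi)) * of_real (?e (b * n))
      = of_real (n * sqrt (2 * pi) * exp (- (b * n)\<^sup>2 / 2)) /\<^sub>R \<bar>n\<bar>"
    using assms by (simp add: scaleR_conv_of_real)
  ultimately show ?thesis
    using assms by (subst lborel_has_bochner_integral_real_affine_iff[of n _ _ 0]) simp_all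
qed

lemma gaussian_integrable:
  assumes "0 < n"
  shows "integrable lborel (\<lambda>\<xi>::real. exp (- (\<xi> / n)\<^sup>2 / 2))"
proof -
  have "integrable lborel (\<lambda>\<xi>. cmod (cis (0 * \<xi>) * of_real (exp (- (\<xi> / n)\<^sup>2 / 2))))"
    using gaussian_fourier_integral[OF assms, of 0] by (intro integrable_norm) (simp add: has_bochner_integral_iff)
  then show ?thesis by (simp add: norm_mult)
qed

text \<open>
  Fubini moves the transform from $f$ to the test function $\psi$.
\<close>
lemma truncated_fourier_multiplication:
  fixes \<psi> :: "real \<Rightarrow> complex"
  assumes f: "square_integrable f" and \<psi>: "integrable lborel \<psi>"
  shows "integrable lborel (\<lambda>\<xi>. truncated_fourier R f \<xi> * \<psi> \<xi>)"
    and "(LINT \<xi>|lborel. truncated_fourier R f \<xi> * \<psi> \<xi>)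
      = (LINT x|lborel. of_real (indicator {-R..R} x * f x) * (LINT \<xi>|lborel. cis (- (x * \<xi>)) * \<psi> \<xi>))"
proof -
  have [measurable]: "f \<in> borel_measurable borel" "\<psi> \<in> borel_measurable borel"
    using f \<psi> by (auto simp: square_integrable_def)
  define \<kappa> where "\<kappa> x = indicator {-R..R} x * f x" for x
  have [measurable]: "\<kappa> \<in> borel_measurable borel" unfolding \<kappa>_def by measurable
  have \<kappa>: "integrable lborel \<kappa>"
    using square_integrable_set_integrable[OF f, of R] by (simp add: set_integrable_def \<kappa>_def[abs_def])
  define k where "k = (\<lambda>(x, \<xi>). of_real (\<kappa> x) * (cis (- (x * \<xi>)) * \<psi> \<xi>))"
  have k: "integrable (lborel \<Otimes>\<^sub>M lborel) k"
  proof (rule lborel_pair.Fubini_integrable)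
    show "k \<in> borel_measurable (lborel \<Otimes>\<^sub>M lborel)" unfolding k_def by measurable
    have "integrable lborel (\<lambda>x. \<bar>\<kappa> x\<bar> * (LINT \<xi>|lborel. cmod (\<psi> \<xi>)))"
      using \<kappa> by (intro integrable_mult_left) auto
    then show "integrable lborel (\<lambda>x. LINT \<xi>|lborel. norm (k (x, \<xi>)))"
      by (simp add: k_def norm_mult)
    show "AE x in lborel. integrable lborel (\<lambda>\<xi>. k (x, \<xi>))"
    proof (rule AE_I2)
      fix x
      have "integrable lborel (\<lambda>\<xi>. cis (- (x * \<xi>)) * \<psi> \<xi>)"
        by (rule Bochner_Integration.integrable_bound[OF \<psi>]) (auto simp: norm_mult)
      then show "integrable lborel (\<lambda>\<xi>. k (x, \<xi>))"
        by (simp add: k_def)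
    qed
  qed
  have trunc: "truncated_fourier R f \<xi> * \<psi> \<xi> = (LINT x|lborel. k (x, \<xi>))" for \<xi>
  proof -
    have "(LINT x|lborel. k (x, \<xi>)) = (LINT x|lborel. (indicator {-R..R} x *\<^sub>R (cis (- (x * \<xi>)) * of_real (f x))) * \<psi> \<xi>)"
      by (intro Bochner_Integration.integral_cong) (auto simp: k_def \<kappa>_def scaleR_conv_of_real)
    then show ?thesis
      by (simp only: truncated_fourier_def set_lebesgue_integral_def integral_mult_left_zero)
  qed
  show "integrable lborel (\<lambda>\<xi>. truncated_fourier R f \<xi> * \<psi> \<xi>)"
    unfolding trunc using lborel_pair.integrable_snd[of "\<lambda>x \<xi>. k (x, \<xi>)"] k by simp
  have "(LINT \<xi>|lborel. truncated_fourier R f \<xi> * \<psi> \<xi>) = (LINT x|lborel. LINT \<xi>|lborel. k (x, \<xi>))"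
    unfolding trunc using lborel_pair.Fubini_integral[of "\<lambda>x \<xi>. k (x, \<xi>)"] k by simp
  then show "(LINT \<xi>|lborel. truncated_fourier R f \<xi> * \<psi> \<xi>)
      = (LINT x|lborel. of_real (indicator {-R..R} x * f x) * (LINT \<xi>|lborel. cis (- (x * \<xi>)) * \<psi> \<xi>))"
    by (simp add: k_def \<kappa>_def)
qed

text \<open>
  Convergence in mean square implies convergence against square integrable test functions, by the
  Cauchy-Schwarz inequality.
\<close>
lemma truncated_fourier_weak_limit:
  fixes \<psi> :: "real \<Rightarrow> complex"
  assumes ft: "has_fourier_transform f g"
    and \<psi>: "integrable lborel \<psi>" "square_integrable \<psi>" and g\<psi>: "integrable lborel (\<lambda>\<xi>. g \<xi> * \<psi> \<xi>)"
  shows "((\<lambda>R. LINT \<xi>|lborel. truncated_fourier R f \<xi> * \<psi> \<xi>) \<longlongrightarrow> (LINT \<xi>|lborel. g \<xi> * \<psi> \<xi>)) at_top"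
proof -
  note D = has_fourier_transformD[OF ft]
  note [measurable] = D(3,4)
  have [measurable]: "\<psi> \<in> borel_measurable borel" using \<psi>(1) by auto
  let ?J = "\<lambda>R. LINT \<xi>|lborel. truncated_fourier R f \<xi> * \<psi> \<xi>" and ?j = "LINT \<xi>|lborel. g \<xi> * \<psi> \<xi>"
  let ?E = "\<lambda>R. \<integral>\<^sup>+ \<xi>. ennreal ((cmod (truncated_fourier R f \<xi> - g \<xi>))\<^sup>2) \<partial>lborel"
  define Q where "Q = (\<integral>\<^sup>+ \<xi>. ennreal ((cmod (\<psi> \<xi>))\<^sup>2) \<partial>lborel)"
  have "Q \<noteq> \<infinity>"
    using \<psi>(2) unfolding Q_def square_integrable_def by (simp add: nn_integral_eq_integral)
  have bound: "ennreal ((cmod (?J R - ?j))\<^sup>2) \<le> ?E R * Q" for R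
  proof -
    note T = truncated_fourier_multiplication(1)[OF D(1) \<psi>(1), of R]
    have "?J R - ?j = (LINT \<xi>|lborel. (truncated_fourier R f \<xi> - g \<xi>) * \<psi> \<xi>)"
      using T g\<psi> by (simp add: left_diff_distrib)
    moreover have "integrable lborel (\<lambda>\<xi>. (truncated_fourier R f \<xi> - g \<xi>) * \<psi> \<xi>)"
      using T g\<psi> by (simp add: left_diff_distrib)
    ultimately have "ennreal (cmod (?J R - ?j)) \<le> (\<integral>\<^sup>+ \<xi>. ennreal (cmod ((truncated_fourier R f \<xi> - g \<xi>) * \<psi> \<xi>)) \<partial>lborel)"
      using integral_norm_bound_ennreal by metis
    also have "\<dots> = (\<integral>\<^sup>+ \<xi>. ennreal (cmod (truncated_fourier R f \<xi> - g \<xi>)) * ennreal (cmod (\<psi> \<xi>)) \<partial>lborel)"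
      by (simp add: norm_mult ennreal_mult)
    finally have "(ennreal (cmod (?J R - ?j)))\<^sup>2 \<le> \<dots>\<^sup>2" by (intro power_mono) auto
    also have "\<dots> \<le> (\<integral>\<^sup>+ \<xi>. (ennreal (cmod (truncated_fourier R f \<xi> - g \<xi>)))\<^sup>2 \<partial>lborel)
        * (\<integral>\<^sup>+ \<xi>. (ennreal (cmod (\<psi> \<xi>)))\<^sup>2 \<partial>lborel)"
      by (intro Cauchy_Schwarz_nn_integral) measurable
    finally show ?thesis by (simp add: ennreal_power Q_def)
  qed
  have "((\<lambda>R. ?E R * Q) \<longlongrightarrow> 0 * Q) at_top"
    using \<open>Q \<noteq> \<infinity>\<close> by (intro tendsto_mult_ennreal tendsto_const D) auto
  then have lim: "((\<lambda>R. ?E R * Q) \<longlongrightarrow> 0) at_top" by simp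
  have "((\<lambda>R. ennreal ((cmod (?J R - ?j))\<^sup>2)) \<longlongrightarrow> 0) at_top"
    by (rule tendsto_sandwich[OF _ _ tendsto_const lim]) (intro always_eventually allI bound zero_le)+
  then have "((\<lambda>R. (cmod (?J R - ?j))\<^sup>2) \<longlongrightarrow> 0) at_top"
    by (subst (asm) tendsto_ennreal_iff[where x = 0, simplified]) auto
  then have "((\<lambda>R. sqrt ((cmod (?J R - ?j))\<^sup>2)) \<longlongrightarrow> sqrt 0) at_top"
    by (rule tendsto_real_sqrt)
  then have "((\<lambda>R. ?J R - ?j) \<longlongrightarrow> 0) at_top" by (simp add: tendsto_norm_zero_iff)
  then show ?thesis by (rule Lim_null[THEN iffD2])
qed

lemma abs_mult_le_sum_squares:
  fixes x y :: real
  shows "\<bar>x * y\<bar> \<le> x\<^sup>2 + y\<^sup>2"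
proof -
  have "0 \<le> (\<bar>x\<bar> - \<bar>y\<bar>)\<^sup>2" "0 \<le> \<bar>x * y\<bar>" by simp_all
  then show ?thesis unfolding power2_diff abs_mult power2_abs by linarith
qed

text \<open>
  Testing against the modulated Gaussian of width $n$ produces a Gaussian average of $f$ at scale
  $1/n$ around $a$.  As $n$ grows, the left side tends to the inversion integral and the right side
  to $2 \pi f(a)$.
\<close>
lemma gaussian_multiplication_formula:
  assumes ft: "has_fourier_transform f g" and g: "integrable lborel g" and n: "0 < n"
  shows "integrable lborel (\<lambda>x. f x * exp (- ((a - x) * n)\<^sup>2 / 2))"
    and "(LINT \<xi>|lborel. g \<xi> * (cis (a * \<xi>) * of_real (exp (- (\<xi> / n)\<^sup>2 / 2))))
      = of_real (n * sqrt (2 * pi) * (LINT x|lborel. f x * exp (- ((a - x) * n)\<^sup>2 / 2)))"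
proof -
  note D = has_fourier_transformD[OF ft]
  note [measurable] = D(3,4)
  let ?\<psi> = "\<lambda>\<xi>. cis (a * \<xi>) * complex_of_real (exp (- (\<xi> / n)\<^sup>2 / 2))"
  let ?k = "\<lambda>x. exp (- ((a - x) * n)\<^sup>2 / 2)"
  have \<psi>: "integrable lborel ?\<psi>"
    using gaussian_fourier_integral[OF n, of a] by (simp add: has_bochner_integral_iff)
  have sq: "(exp (- (\<xi> / n)\<^sup>2 / 2))\<^sup>2 = exp (- (\<xi> / (n / sqrt 2))\<^sup>2 / 2)" for \<xi> :: real
    by (simp add: power2_eq_square exp_add[symmetric] field_simps)
  have \<psi>2: "square_integrable ?\<psi>"
  proof -
    have "(cmod (?\<psi> \<xi>))\<^sup>2 = exp (- (\<xi> / (n / sqrt 2))\<^sup>2 / 2)" for \<xi>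
      unfolding norm_mult norm_cis norm_of_real abs_exp_cancel mult_1 by (rule sq)
    then show ?thesis
      using gaussian_integrable[of "n / sqrt 2"] n by (simp only: square_integrable_def) simp
  qed
  have g\<psi>: "integrable lborel (\<lambda>\<xi>. g \<xi> * ?\<psi> \<xi>)"
    by (rule Bochner_Integration.integrable_bound[OF g])
       (auto intro!: AE_I2 mult_right_le_one_le simp: norm_mult)
  have k: "integrable lborel (\<lambda>x. (?k x)\<^sup>2)"
  proof -
    have "(?k x)\<^sup>2 = exp (- ((a + (-1) * x) / (1 / (sqrt 2 * n)))\<^sup>2 / 2)" for x
      by (simp add: power2_eq_square exp_add[symmetric] field_simps)
    then show ?thesis
      using lborel_integrable_real_affine[OF gaussian_integrable[of "1 / (sqrt 2 * n)"], of "-1" a] n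
      by (simp del: power_divide)
  qed
  show fk: "integrable lborel (\<lambda>x. f x * ?k x)"
  proof (rule Bochner_Integration.integrable_bound)
    show "integrable lborel (\<lambda>x. (f x)\<^sup>2 + (?k x)\<^sup>2)"
      using D(1) k by (auto simp: square_integrable_def)
    show "AE x in lborel. norm (f x * ?k x) \<le> norm ((f x)\<^sup>2 + (?k x)\<^sup>2)"
    proof (rule AE_I2)
      fix x
      show "norm (f x * ?k x) \<le> norm ((f x)\<^sup>2 + (?k x)\<^sup>2)"
        using abs_mult_le_sum_squares[of "f x" "?k x"] by simp
    qed
  qed measurable
  have inner: "(LINT \<xi>|lborel. cis (- (x * \<xi>)) * ?\<psi> \<xi>) = of_real (n * sqrt (2 * pi) * ?k x)" for x
  proof -
    have "cis (- (x * \<xi>)) * ?\<psi> \<xi> = cis ((a - x) * \<xi>) * of_real (exp (- (\<xi> / n)\<^sup>2 / 2))" for \<xi>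
      by (simp only: mult.assoc[symmetric] cis_mult) (simp add: left_diff_distrib)
    then show ?thesis
      by (simp only: has_bochner_integral_integral_eq[OF gaussian_fourier_integral[OF n, of "a - x"]])
  qed
  have "(LINT \<xi>|lborel. truncated_fourier R f \<xi> * ?\<psi> \<xi>)
      = of_real (n * sqrt (2 * pi) * (LINT x|lborel. indicator {-R..R} x * (f x * ?k x)))" for R
  proof -
    have "(LINT \<xi>|lborel. truncated_fourier R f \<xi> * ?\<psi> \<xi>)
        = (LINT x|lborel. of_real (indicator {-R..R} x * f x) * of_real (n * sqrt (2 * pi) * ?k x))"
      unfolding truncated_fourier_multiplication(2)[OF D(1) \<psi>] inner ..
    also have "\<dots> = (LINT x|lborel. complex_of_real (n * sqrt (2 * pi) * (indicator {-R..R} x * (f x * ?k x))))"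
      by (simp only: of_real_mult mult_ac)
    finally show ?thesis
      by (simp only: integral_complex_of_real integral_mult_right_zero)
  qed
  moreover have "((\<lambda>R. LINT x|lborel. indicator {-R..R} x * (f x * ?k x)) \<longlongrightarrow> (LINT x|lborel. f x * ?k x)) at_top"
  proof (rule integral_dominated_convergence_at_top)
    show "integrable lborel (\<lambda>x. \<bar>f x * ?k x\<bar>)" using fk by (rule integrable_abs)
    show "\<forall>\<^sub>F R in at_top. AE x in lborel. norm (indicator {-R..R} x * (f x * ?k x)) \<le> \<bar>f x * ?k x\<bar>"
      by (intro always_eventually allI AE_I2) (auto simp: indicator_def)
    show "AE x in lborel. ((\<lambda>R. indicator {-R..R} x * (f x * ?k x)) \<longlongrightarrow> f x * ?k x) at_top"
    proof (rule AE_I2)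
      fix x
      have "\<forall>\<^sub>F R in at_top. indicator {-R..R} x * (f x * ?k x) = f x * ?k x"
        using eventually_ge_at_top[of "\<bar>x\<bar>"] by eventually_elim (auto simp: indicator_def)
      then show "((\<lambda>R. indicator {-R..R} x * (f x * ?k x)) \<longlongrightarrow> f x * ?k x) at_top"
        by (rule tendsto_eventually)
    qed
  qed measurable
  ultimately have "((\<lambda>R. LINT \<xi>|lborel. truncated_fourier R f \<xi> * ?\<psi> \<xi>)
      \<longlongrightarrow> of_real (n * sqrt (2 * pi) * (LINT x|lborel. f x * ?k x))) at_top"
    by (simp only:) (intro tendsto_of_real tendsto_mult tendsto_const)
  with truncated_fourier_weak_limit[OF ft \<psi> \<psi>2 g\<psi>]
  show "(LINT \<xi>|lborel. g \<xi> * ?\<psi> \<xi>) = of_real (n * sqrt (2 * pi) * (LINT x|lborel. f x * ?k x))"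
    by (rule tendsto_unique[rotated]) simp
qed


lemma gaussian_mass:
  shows "integrable lborel (\<lambda>z::real. exp (- z\<^sup>2 / 2))"
    and "(LINT z|lborel. exp (- z\<^sup>2 / 2 :: real)) = sqrt (2 * pi)"
proof -
  show int: "integrable lborel (\<lambda>z::real. exp (- z\<^sup>2 / 2))"
    using gaussian_integrable[of 1] by simp
  have "complex_of_real (LINT z|lborel. exp (- z\<^sup>2 / 2)) = of_real (sqrt (2 * pi))"
    using gaussian_fourier_integral[of 1 0] by (simp add: has_bochner_integral_iff)
  then show "(LINT z|lborel. exp (- z\<^sup>2 / 2 :: real)) = sqrt (2 * pi)"
    by (simp only: of_real_eq_iff)
qed

text \<open>
  Substituting $x = a + z/n$ makes the Gaussian independent of $n$; on the fixed interval $f$ is bounded,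
  so dominated convergence applies.
\<close>
lemma gaussian_average_near:
  fixes f :: "real \<Rightarrow> real"
  assumes cont: "continuous_on UNIV f"
  shows "(\<lambda>m. real (Suc m) * (LINT x|lborel. indicator {a-1..a+1} x * (f x * exp (- ((a - x) * real (Suc m))\<^sup>2 / 2))))
           \<longlonglongrightarrow> sqrt (2 * pi) * f a"
proof -
  have [measurable]: "f \<in> borel_measurable borel" using cont by (rule borel_measurable_continuous_onI)
  have "bounded (f ` {a-1..a+1})"
    by (intro compact_imp_bounded compact_continuous_image continuous_on_subset[OF cont]) auto
  then obtain C where "\<forall>y\<in>f ` {a-1..a+1}. norm y \<le> C" unfolding bounded_iff by blast
  then have C: "\<bar>f x\<bar> \<le> C" if "x \<in> {a-1..a+1}" for x using that by auto
  define F where "F m z = indicator {a-1..a+1} (a + z / real (Suc m)) * (f (a + z / real (Suc m)) * exp (- z\<^sup>2 / 2))" for m z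
  have subst: "real (Suc m) * (LINT x|lborel. indicator {a-1..a+1} x * (f x * exp (- ((a - x) * real (Suc m))\<^sup>2 / 2)))
      = (LINT z|lborel. F m z)" for m
  proof -
    have "(a - (a + 1 / real (Suc m) * z)) * real (Suc m) = - z" for z
      by (simp add: field_simps del: of_nat_Suc)
    then show ?thesis
      by (subst lborel_integral_real_affine[of "1 / real (Suc m)" _ a])
         (simp_all add: F_def[abs_def] del: of_nat_Suc)
  qed
  have "(\<lambda>m. LINT z|lborel. F m z) \<longlonglongrightarrow> (LINT z|lborel. f a * exp (- z\<^sup>2 / 2))"
  proof (rule integral_dominated_convergence)
    show "integrable lborel (\<lambda>z. C * exp (- z\<^sup>2 / 2))"
      by (intro integrable_mult_right gaussian_mass)
    show "AE z in lborel. norm (F m z) \<le> C * exp (- z\<^sup>2 / 2)" for m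
    proof (rule AE_I2)
      fix z
      have "0 \<le> C" using C[of a] by simp
      then show "norm (F m z) \<le> C * exp (- z\<^sup>2 / 2)"
        using C[of "a + z / real (Suc m)"]
        by (cases "a + z / real (Suc m) \<in> {a-1..a+1}") (auto simp: F_def abs_mult simp del: of_nat_Suc)
    qed
    show "AE z in lborel. (\<lambda>m. F m z) \<longlonglongrightarrow> f a * exp (- z\<^sup>2 / 2)"
    proof (rule AE_I2)
      fix z
      have "(\<lambda>m. z * inverse (real (Suc m))) \<longlonglongrightarrow> z * 0"
        by (intro tendsto_mult tendsto_const LIMSEQ_inverse_real_of_nat)
      then have lim: "(\<lambda>m. a + z / real (Suc m)) \<longlonglongrightarrow> a + 0"
        by (intro tendsto_add tendsto_const) (simp add: divide_inverse)
      then have "(\<lambda>m. f (a + z / real (Suc m))) \<longlonglongrightarrow> f a"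
        using cont by (intro continuous_on_tendsto_compose[OF cont, of "\<lambda>m. a + z / real (Suc m)" a]) auto
      then have 1: "(\<lambda>m. f (a + z / real (Suc m)) * exp (- z\<^sup>2 / 2)) \<longlonglongrightarrow> f a * exp (- z\<^sup>2 / 2)"
        by (intro tendsto_mult tendsto_const)
      have "\<forall>\<^sub>F m in sequentially. dist (a + z / real (Suc m)) (a + 0) < 1"
        using lim by (rule tendstoD) simp
      then have "\<forall>\<^sub>F m in sequentially. f (a + z / real (Suc m)) * exp (- z\<^sup>2 / 2) = F m z"
      proof eventually_elim
        case (elim m)
        then have "a + z / real (Suc m) \<in> {a-1..a+1}"
          unfolding dist_real_def atLeastAtMost_iff by linarith
        then show ?case by (simp add: F_def del: of_nat_Suc)
      qed
      with 1 show "(\<lambda>m. F m z) \<longlonglongrightarrow> f a * exp (- z\<^sup>2 / 2)"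
        by (rule Lim_transform_eventually)
    qed
    show "F m \<in> borel_measurable lborel" for m unfolding F_def by measurable
  qed measurable
  also have "(LINT z|lborel. f a * exp (- z\<^sup>2 / 2)) = sqrt (2 * pi) * f a"
    using gaussian_mass by simp
  finally show ?thesis unfolding subst .
qed

text \<open>
  Half of the exponent pays for the factor $n$ in front of the average, the other half
  keeps integrability in $y$.
\<close>
lemma gaussian_tail_exponent:
  fixes n y :: real
  assumes "1 \<le> n" "1 < \<bar>y\<bar>"
  shows "- (y * n)\<^sup>2 / 2 \<le> - n / 4 + - y\<^sup>2 / 4"
proof -
  have y: "1 \<le> y\<^sup>2" using assms(2) one_le_power[of "\<bar>y\<bar>" 2] by simp
  have n: "1 \<le> n\<^sup>2" "n \<le> n\<^sup>2"
    using assms(1) one_le_power[of n 2] self_le_power[of n 2] by simp_all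
  have "n * 1 \<le> n\<^sup>2 * y\<^sup>2" using n y assms(1) by (intro mult_mono) auto
  moreover have "1 * y\<^sup>2 \<le> n\<^sup>2 * y\<^sup>2" using n by (intro mult_right_mono) auto
  moreover have "0 \<le> n" using assms(1) by simp
  moreover have "(y * n)\<^sup>2 = n\<^sup>2 * y\<^sup>2" by (simp add: power_mult_distrib)
  ultimately show ?thesis by linarith
qed

lemma linear_mult_exp_neg_tendsto:
  "(\<lambda>m. real (Suc m) * exp (- real (Suc m) / 4)) \<longlonglongrightarrow> 0"
proof -
  have lim: "((\<lambda>y::real. 4 * (y ^ 1 / exp y)) \<longlongrightarrow> 4 * 0) at_top"
    by (intro tendsto_mult[OF tendsto_const] tendsto_power_div_exp_0)
  have "filterlim (\<lambda>m. 1 / 4 * real (Suc m)) at_top sequentially"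
    by (rule filterlim_tendsto_pos_mult_at_top[OF tendsto_const _
          filterlim_compose[OF filterlim_real_sequentially filterlim_Suc]]) simp
  note L = filterlim_compose[OF lim this]
  have "4 * ((1 / 4 * n) ^ 1 / exp (1 / 4 * n)) = n * exp (- n / 4)" for n :: real
  proof -
    have "exp (- n / 4) = 1 / exp (1 / 4 * n)"
      using exp_minus[of "n / 4"] by (simp only: inverse_eq_divide) simp
    then show ?thesis by (simp only:) simp
  qed
  with L show ?thesis by (simp only: mult_zero_right)
qed

text \<open>
  No pointwise bound on $f$ is available at infinity, only square integrability.  At distance more
  than $1$ from $a$ the Gaussian factors as $e^{-n/4}$ times a fixed Gaussian, against which $f$ is integrable.
\<close>
lemma gaussian_average_far:
  fixes f :: "real \<Rightarrow> real"
  assumes f: "square_integrable f"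
  shows "(\<lambda>m. real (Suc m) * (LINT x|lborel. indicator (- {a-1..a+1}) x * (f x * exp (- ((a - x) * real (Suc m))\<^sup>2 / 2))))
           \<longlonglongrightarrow> 0"
proof -
  have [measurable]: "f \<in> borel_measurable borel" using f by (simp add: square_integrable_def)
  let ?k = "\<lambda>x. exp (- (a - x)\<^sup>2 / 4)"
  have kint: "integrable lborel (\<lambda>x. (f x)\<^sup>2 + exp (- (a - x)\<^sup>2 / 2))"
  proof (intro Bochner_Integration.integrable_add)
    show "integrable lborel (\<lambda>x. exp (- (a - x)\<^sup>2 / 2))"
      using lborel_integrable_real_affine[OF gaussian_mass(1), of "-1" a] by simp
  qed (use f in \<open>simp add: square_integrable_def\<close>)
  have fk: "integrable lborel (\<lambda>x. \<bar>f x\<bar> * ?k x)"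
  proof (rule Bochner_Integration.integrable_bound[OF kint])
    show "AE x in lborel. norm (\<bar>f x\<bar> * ?k x) \<le> norm ((f x)\<^sup>2 + exp (- (a - x)\<^sup>2 / 2))"
    proof (rule AE_I2)
      fix x
      have "(?k x)\<^sup>2 = exp (- (a - x)\<^sup>2 / 2)"
        by (simp add: power2_eq_square exp_add[symmetric])
      then show "norm (\<bar>f x\<bar> * ?k x) \<le> norm ((f x)\<^sup>2 + exp (- (a - x)\<^sup>2 / 2))"
        using abs_mult_le_sum_squares[of "\<bar>f x\<bar>" "?k x"] by simp
    qed
  qed measurable
  define I where "I = (LINT x|lborel. \<bar>f x\<bar> * ?k x)"
  have bound: "norm (real (Suc m) * (LINT x|lborel. indicator (- {a-1..a+1}) x * (f x * exp (- ((a - x) * real (Suc m))\<^sup>2 / 2))))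
      \<le> real (Suc m) * exp (- real (Suc m) / 4) * I" for m
  proof -
    let ?n = "real (Suc m)"
    have "norm (LINT x|lborel. indicator (- {a-1..a+1}) x * (f x * exp (- ((a - x) * ?n)\<^sup>2 / 2)))
        \<le> (LINT x|lborel. exp (- ?n / 4) * (\<bar>f x\<bar> * ?k x))"
    proof (rule integral_norm_bound_AE)
      show "AE x in lborel. norm (indicator (- {a-1..a+1}) x * (f x * exp (- ((a - x) * ?n)\<^sup>2 / 2)))
          \<le> exp (- ?n / 4) * (\<bar>f x\<bar> * ?k x)"
      proof (rule AE_I2)
        fix x
        show "norm (indicator (- {a-1..a+1}) x * (f x * exp (- ((a - x) * ?n)\<^sup>2 / 2)))
            \<le> exp (- ?n / 4) * (\<bar>f x\<bar> * ?k x)"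
        proof (cases "x \<in> {a-1..a+1}")
          case False
          then have "1 < \<bar>a - x\<bar>" by auto
          then have "- ((a - x) * ?n)\<^sup>2 / 2 \<le> - ?n / 4 + - (a - x)\<^sup>2 / 4"
            by (intro gaussian_tail_exponent) auto
          then have "exp (- ((a - x) * ?n)\<^sup>2 / 2) \<le> exp (- ?n / 4) * ?k x"
            unfolding exp_add[symmetric] exp_le_cancel_iff .
          then have "\<bar>f x\<bar> * exp (- ((a - x) * ?n)\<^sup>2 / 2) \<le> \<bar>f x\<bar> * (exp (- ?n / 4) * ?k x)"
            by (intro mult_left_mono) auto
          then show ?thesis using False by (simp add: abs_mult mult_ac del: of_nat_Suc)
        qed (simp add: indicator_def)
      qed
      show "integrable lborel (\<lambda>x. exp (- ?n / 4) * (\<bar>f x\<bar> * ?k x))"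
        using fk by (rule integrable_mult_right)
    qed
    then show ?thesis
      by (simp add: abs_mult I_def mult_left_mono mult.assoc del: of_nat_Suc)
  qed
  have "(\<lambda>m. real (Suc m) * exp (- real (Suc m) / 4) * I) \<longlonglongrightarrow> 0 * I"
    by (rule tendsto_mult[OF linear_mult_exp_neg_tendsto tendsto_const])
  then have lim: "(\<lambda>m. real (Suc m) * exp (- real (Suc m) / 4) * I) \<longlonglongrightarrow> 0" by simp
  show ?thesis by (rule Lim_null_comparison[OF always_eventually lim]) (intro allI bound)
qed

text \<open>
  Both sides of the Gaussian multiplication formula converge: the left one by dominated convergence
  since $g$ is integrable, the right one by the limits of its near and far parts.
\<close>
lemma fourier_inversion:
  assumes ft: "has_fourier_transform f g" and cont: "continuous_on UNIV f" and g: "integrable lborel g"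
  shows "complex_of_real (2 * pi * f a) = (LINT \<xi>|lborel. cis (a * \<xi>) * g \<xi>)"
proof -
  note D = has_fourier_transformD[OF ft]
  note [measurable] = D(3,4)
  let ?n = "\<lambda>m. real (Suc m)"
  let ?k = "\<lambda>m x. exp (- ((a - x) * ?n m)\<^sup>2 / 2)"
  let ?L = "\<lambda>m. LINT \<xi>|lborel. g \<xi> * (cis (a * \<xi>) * of_real (exp (- (\<xi> / ?n m)\<^sup>2 / 2)))"
  have "?L \<longlonglongrightarrow> (LINT \<xi>|lborel. g \<xi> * (cis (a * \<xi>) * 1))"
  proof (rule integral_dominated_convergence)
    show "integrable lborel (\<lambda>\<xi>. cmod (g \<xi>))" using g by (rule integrable_norm)
    show "AE \<xi> in lborel. norm (g \<xi> * (cis (a * \<xi>) * of_real (exp (- (\<xi> / ?n m)\<^sup>2 / 2)))) \<le> cmod (g \<xi>)" for m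
      by (auto intro!: AE_I2 mult_right_le_one_le simp: norm_mult)
    show "AE \<xi> in lborel. (\<lambda>m. g \<xi> * (cis (a * \<xi>) * of_real (exp (- (\<xi> / ?n m)\<^sup>2 / 2)))) \<longlonglongrightarrow> g \<xi> * (cis (a * \<xi>) * 1)"
    proof (rule AE_I2)
      fix \<xi>
      have "(\<lambda>m. \<xi> * inverse (?n m)) \<longlonglongrightarrow> \<xi> * 0"
        by (intro tendsto_mult tendsto_const LIMSEQ_inverse_real_of_nat)
      then have "(\<lambda>m. exp (- (\<xi> / ?n m)\<^sup>2 / 2)) \<longlonglongrightarrow> exp (- (\<xi> * 0)\<^sup>2 / 2)"
        unfolding divide_inverse[of \<xi>] by (intro tendsto_exp tendsto_divide tendsto_minus tendsto_power tendsto_const) auto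
      then have "(\<lambda>m. complex_of_real (exp (- (\<xi> / ?n m)\<^sup>2 / 2))) \<longlonglongrightarrow> 1"
        using tendsto_of_real by force
      then show "(\<lambda>m. g \<xi> * (cis (a * \<xi>) * of_real (exp (- (\<xi> / ?n m)\<^sup>2 / 2)))) \<longlonglongrightarrow> g \<xi> * (cis (a * \<xi>) * 1)"
        by (intro tendsto_mult tendsto_const)
    qed
  qed measurable
  moreover have "?L \<longlonglongrightarrow> of_real (sqrt (2 * pi) * (sqrt (2 * pi) * f a + 0))"
  proof -
    have "?L m = of_real (sqrt (2 * pi) * (?n m * (LINT x|lborel. indicator {a-1..a+1} x * (f x * ?k m x))
        + ?n m * (LINT x|lborel. indicator (- {a-1..a+1}) x * (f x * ?k m x))))" for m
    proof -
      have pos: "0 < ?n m" by simp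
      note int = gaussian_multiplication_formula(1)[OF ft g pos, of a]
      have "(LINT x|lborel. f x * ?k m x)
          = (LINT x|lborel. indicator {a-1..a+1} x * (f x * ?k m x) + indicator (- {a-1..a+1}) x * (f x * ?k m x))"
        by (intro Bochner_Integration.integral_cong) (auto simp: indicator_def)
      also have "\<dots> = (LINT x|lborel. indicator {a-1..a+1} x * (f x * ?k m x))
          + (LINT x|lborel. indicator (- {a-1..a+1}) x * (f x * ?k m x))"
      proof (rule Bochner_Integration.integral_add)
        show "integrable lborel (\<lambda>x. indicator {a-1..a+1} x * (f x * ?k m x))"
          using integrable_mult_indicator[OF _ int, of "{a-1..a+1}"] by simp
        show "integrable lborel (\<lambda>x. indicator (- {a-1..a+1}) x * (f x * ?k m x))"
          using integrable_mult_indicator[OF _ int, of "- {a-1..a+1}"] by simp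
      qed
      finally show ?thesis
        unfolding gaussian_multiplication_formula(2)[OF ft g pos] of_real_eq_iff
        by (simp only: distrib_left mult_ac)
    qed
    then show ?thesis
      by (simp only:) (intro tendsto_of_real tendsto_mult tendsto_add tendsto_const
          gaussian_average_near[OF cont] gaussian_average_far[OF D(1)])
  qed
  ultimately have "(LINT \<xi>|lborel. g \<xi> * (cis (a * \<xi>) * 1)) = of_real (sqrt (2 * pi) * (sqrt (2 * pi) * f a + 0))"
    by (rule LIMSEQ_unique)
  moreover have "sqrt (2 * pi) * (sqrt (2 * pi) * f a + 0) = 2 * pi * f a"
    by (simp add: mult.assoc[symmetric])
  moreover have "(LINT \<xi>|lborel. g \<xi> * (cis (a * \<xi>) * 1)) = (LINT \<xi>|lborel. cis (a * \<xi>) * g \<xi>)"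
    by (simp add: mult.commute)
  ultimately show ?thesis by (simp only:)
qed

section \<open>Sobolev embedding\<close>

text \<open>
  Comparison with $(1 + |\xi|)^{-2\sigma}$, whose primitive is explicit.
\<close>
lemma japanese_bracket_integrable:
  assumes "1 / 2 < \<sigma>"
  shows "integrable lborel (\<lambda>\<xi>::real. (1 + \<xi>\<^sup>2) powr (- \<sigma>))"
proof -
  define p where "p = 2 * \<sigma> - 1"
  have p: "0 < p" using assms by (simp add: p_def)
  have "has_bochner_integral lborel (\<lambda>y::real. indicator {0..} y * (1 + \<bar>y\<bar>) powr (- p - 1)) (1 / p)"
  proof (rule has_bochner_integral_nn_integral)
    have "(\<integral>\<^sup>+ y. ennreal ((1 + \<bar>y\<bar>) powr (- p - 1)) * indicator {0..} y \<partial>lborel)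
        = ennreal (0 - (- ((1 + 0) powr (- p)) / p))"
    proof (rule nn_integral_FTC_atLeast)
      show "((\<lambda>y. - ((1 + y) powr (- p)) / p) \<longlongrightarrow> 0) at_top"
      proof -
        have "LIM y at_top. 1 + y :: real :> at_top"
          by (intro filterlim_tendsto_add_at_top[OF tendsto_const] filterlim_ident)
        then have "((\<lambda>y. (1 + y) powr (- p)) \<longlongrightarrow> 0) at_top"
          using p by (intro tendsto_neg_powr) auto
        then show ?thesis
          using tendsto_divide[OF tendsto_minus tendsto_const, of "\<lambda>y. (1 + y) powr (- p)" 0 at_top p] p by simp
      qed
      show "((\<lambda>y. - ((1 + y) powr (- p)) / p) has_real_derivative (1 + \<bar>y\<bar>) powr (- p - 1)) (at y)"
        if "0 \<le> y" for y
        using p that by (auto intro!: derivative_eq_intros simp: powr_diff)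
    qed auto
    then show "(\<integral>\<^sup>+ y. ennreal (indicator {0..} y * (1 + \<bar>y\<bar>) powr (- p - 1)) \<partial>lborel) = ennreal (1 / p)"
      by (simp add: ennreal_mult' ennreal_indicator mult.commute)
  qed (use p in auto)
  from has_bochner_integral_abs[OF this]
  have int: "integrable lborel (\<lambda>y::real. 2 powr \<sigma> * (1 + \<bar>y\<bar>) powr (- p - 1))"
    by (intro integrable_mult_right) (simp add: has_bochner_integral_iff)
  show ?thesis
  proof (rule Bochner_Integration.integrable_bound[OF int])
    show "AE \<xi> in lborel. norm ((1 + \<xi>\<^sup>2) powr (- \<sigma>)) \<le> norm (2 powr \<sigma> * (1 + \<bar>\<xi>\<bar>) powr (- p - 1))"
    proof (rule AE_I2)
      fix \<xi> :: real
      have "(1 + \<bar>\<xi>\<bar>)\<^sup>2 \<le> 2 * (1 + \<xi>\<^sup>2)"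
        using zero_le_power2[of "1 - \<bar>\<xi>\<bar>"] by (simp add: power2_eq_square algebra_simps)
      then have "(1 + \<bar>\<xi>\<bar>)\<^sup>2 / 2 \<le> 1 + \<xi>\<^sup>2" by simp
      then have "(1 + \<xi>\<^sup>2) powr (- \<sigma>) \<le> ((1 + \<bar>\<xi>\<bar>)\<^sup>2 / 2) powr (- \<sigma>)"
        using assms by (intro powr_mono2') auto
      also have "(1 + \<bar>\<xi>\<bar>)\<^sup>2 = (1 + \<bar>\<xi>\<bar>) powr 2" by simp
      also have "((1 + \<bar>\<xi>\<bar>) powr 2 / 2) powr (- \<sigma>) = 2 powr \<sigma> * (1 + \<bar>\<xi>\<bar>) powr (- p - 1)"
        unfolding powr_divide powr_powr by (simp add: p_def powr_minus divide_inverse mult.commute)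
      finally show "norm ((1 + \<xi>\<^sup>2) powr (- \<sigma>)) \<le> norm (2 powr \<sigma> * (1 + \<bar>\<xi>\<bar>) powr (- p - 1))"
        by simp
    qed
  qed measurable
qed

text \<open>
  The $L^2$ norm of $(1 + \xi^2)^{-\sigma/2}$, the best constant in the weighted embedding of $L^2$ into $L^1$.
\<close>
definition embedding_constant :: "real \<Rightarrow> real" where
  "embedding_constant \<sigma> = sqrt (LINT \<xi>|lborel. (1 + \<xi>\<^sup>2) powr (- \<sigma>))"

text \<open>
  Cauchy-Schwarz for the splitting
  $|h| = (1 + \xi^2)^{-\sigma/2} \cdot (1 + \xi^2)^{\sigma/2} |h|$.
\<close>
lemma weighted_L2_imp_L1:
  fixes h :: "real \<Rightarrow> complex"
  assumes \<sigma>: "1 / 2 < \<sigma>" and [measurable]: "h \<in> borel_measurable borel"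
    and int: "integrable lborel (\<lambda>\<xi>. (1 + \<xi>\<^sup>2) powr \<sigma> * (cmod (h \<xi>))\<^sup>2)"
  shows "integrable lborel h"
    and "(LINT \<xi>|lborel. cmod (h \<xi>))
      \<le> embedding_constant \<sigma> * sqrt (LINT \<xi>|lborel. (1 + \<xi>\<^sup>2) powr \<sigma> * (cmod (h \<xi>))\<^sup>2)"
proof -
  let ?w = "\<lambda>\<xi>::real. (1 + \<xi>\<^sup>2) powr (\<sigma> / 2)" and ?v = "\<lambda>\<xi>::real. (1 + \<xi>\<^sup>2) powr (- (\<sigma> / 2))"
  let ?C = "LINT \<xi>|lborel. (1 + \<xi>\<^sup>2) powr (- \<sigma>)" and ?N = "LINT \<xi>|lborel. (1 + \<xi>\<^sup>2) powr \<sigma> * (cmod (h \<xi>))\<^sup>2"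
  have pos: "0 < 1 + \<xi>\<^sup>2" for \<xi> :: real by (simp add: add_pos_nonneg)
  have split: "cmod (h \<xi>) = ?v \<xi> * (?w \<xi> * cmod (h \<xi>))" for \<xi>
    using pos[of \<xi>] by (simp add: mult.assoc[symmetric] powr_add[symmetric])
  have v2: "(?v \<xi>)\<^sup>2 = (1 + \<xi>\<^sup>2) powr (- \<sigma>)" and w2: "(?w \<xi>)\<^sup>2 = (1 + \<xi>\<^sup>2) powr \<sigma>" for \<xi>
    by (simp_all add: power2_eq_square powr_add[symmetric])
  note J = japanese_bracket_integrable[OF \<sigma>]
  show hint: "integrable lborel h"
  proof (rule Bochner_Integration.integrable_bound)
    show "integrable lborel (\<lambda>\<xi>. (1 + \<xi>\<^sup>2) powr (- \<sigma>) + (1 + \<xi>\<^sup>2) powr \<sigma> * (cmod (h \<xi>))\<^sup>2)"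
      using J int by (rule Bochner_Integration.integrable_add)
    show "AE \<xi> in lborel. norm (h \<xi>) \<le> norm ((1 + \<xi>\<^sup>2) powr (- \<sigma>) + (1 + \<xi>\<^sup>2) powr \<sigma> * (cmod (h \<xi>))\<^sup>2)"
    proof (rule AE_I2)
      fix \<xi>
      have "\<bar>cmod (h \<xi>)\<bar> \<le> (1 + \<xi>\<^sup>2) powr (- \<sigma>) + (1 + \<xi>\<^sup>2) powr \<sigma> * (cmod (h \<xi>))\<^sup>2"
        using abs_mult_le_sum_squares[of "?v \<xi>" "?w \<xi> * cmod (h \<xi>)"]
        unfolding split[of \<xi>, symmetric] power_mult_distrib v2 w2 .
      then show "norm (h \<xi>) \<le> norm ((1 + \<xi>\<^sup>2) powr (- \<sigma>) + (1 + \<xi>\<^sup>2) powr \<sigma> * (cmod (h \<xi>))\<^sup>2)"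
        by simp
    qed
  qed simp
  have "ennreal ((LINT \<xi>|lborel. cmod (h \<xi>))\<^sup>2) = (\<integral>\<^sup>+ \<xi>. ennreal (?v \<xi>) * ennreal (?w \<xi> * cmod (h \<xi>)) \<partial>lborel)\<^sup>2"
  proof -
    have "ennreal (?v \<xi>) * ennreal (?w \<xi> * cmod (h \<xi>)) = ennreal (cmod (h \<xi>))" for \<xi>
      unfolding ennreal_mult[symmetric, OF powr_ge_zero mult_nonneg_nonneg[OF powr_ge_zero norm_ge_zero]]
        split[of \<xi>, symmetric] ..
    then show ?thesis
      using nn_integral_eq_integral[OF integrable_norm[OF hint]] by (simp add: ennreal_power)
  qed
  also have "\<dots> \<le> (\<integral>\<^sup>+ \<xi>. (ennreal (?v \<xi>))\<^sup>2 \<partial>lborel) * (\<integral>\<^sup>+ \<xi>. (ennreal (?w \<xi> * cmod (h \<xi>)))\<^sup>2 \<partial>lborel)"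
    by (intro Cauchy_Schwarz_nn_integral) measurable
  also have "\<dots> = ennreal (?C * ?N)"
    using nn_integral_eq_integral[OF J] nn_integral_eq_integral[OF int]
    by (simp add: ennreal_power v2 w2 power_mult_distrib ennreal_mult)
  finally have "(LINT \<xi>|lborel. cmod (h \<xi>))\<^sup>2 \<le> ?C * ?N"
    by (subst (asm) ennreal_le_iff) (auto intro!: mult_nonneg_nonneg integral_nonneg_AE)
  then have "(LINT \<xi>|lborel. cmod (h \<xi>)) \<le> sqrt (?C * ?N)"
    by (rule real_le_rsqrt)
  then show "(LINT \<xi>|lborel. cmod (h \<xi>)) \<le> embedding_constant \<sigma> * sqrt ?N"
    by (simp add: embedding_constant_def real_sqrt_mult)
qed

lemma inverse_fourier_norm_le:
  fixes h :: "real \<Rightarrow> complex"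
  assumes "integrable lborel h"
  shows "cmod (LINT \<xi>|lborel. cis (x * \<xi>) * h \<xi>) \<le> (LINT \<xi>|lborel. cmod (h \<xi>))"
  by (rule integral_norm_bound_AE) (use assms in \<open>auto simp: norm_mult\<close>)

lemma inverse_fourier_continuous:
  fixes h :: "real \<Rightarrow> complex"
  assumes h: "integrable lborel h"
  shows "continuous_on UNIV (\<lambda>x. LINT \<xi>|lborel. cis (x * \<xi>) * h \<xi>)"
proof (rule continuous_at_imp_continuous_on, intro ballI)
  have [measurable]: "h \<in> borel_measurable borel" using h by auto
  fix x
  have "(\<lambda>n. LINT \<xi>|lborel. cis (X n * \<xi>) * h \<xi>) \<longlonglongrightarrow> (LINT \<xi>|lborel. cis (x * \<xi>) * h \<xi>)"
    if X: "X \<longlonglongrightarrow> x" for X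
  proof (rule integral_dominated_convergence)
    show "integrable lborel (\<lambda>\<xi>. cmod (h \<xi>))" using h by (rule integrable_norm)
    show "AE \<xi> in lborel. (\<lambda>n. cis (X n * \<xi>) * h \<xi>) \<longlonglongrightarrow> cis (x * \<xi>) * h \<xi>"
      by (intro AE_I2 tendsto_mult tendsto_const tendsto_cis X)
  qed (auto simp: norm_mult)
  then show "isCont (\<lambda>x. LINT \<xi>|lborel. cis (x * \<xi>) * h \<xi>) x"
    unfolding isCont_def LIMSEQ_SEQ_conv[symmetric] by blast
qed

lemma norm_cis_diff_le: "cmod (cis y - cis z) \<le> \<bar>y - z\<bar>"
proof -
  have "cis y - cis z = cis z * (cis (y - z) - 1)"
    by (simp add: right_diff_distrib cis_mult)
  then show ?thesis
    using iexp_approx1[of "y - z" 0] by (simp add: norm_mult cis_conv_exp)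
qed

text \<open>
  The difference quotients of $e^{i x \xi}$ are dominated by $|\xi|$, and $\xi h(\xi)$ is integrable.
\<close>
lemma inverse_fourier_has_derivative:
  fixes h :: "real \<Rightarrow> complex"
  assumes h: "integrable lborel h" and h': "integrable lborel (\<lambda>\<xi>. of_real \<xi> * h \<xi>)"
  shows "((\<lambda>y. ((LINT \<xi>|lborel. cis (y * \<xi>) * h \<xi>) - (LINT \<xi>|lborel. cis (x * \<xi>) * h \<xi>)) /\<^sub>R (y - x))
      \<longlongrightarrow> (LINT \<xi>|lborel. cis (x * \<xi>) * (\<i> * (of_real \<xi> * h \<xi>)))) (at x)"
proof -
  have [measurable]: "h \<in> borel_measurable borel" using h by auto
  let ?F = "\<lambda>x. LINT \<xi>|lborel. cis (x * \<xi>) * h \<xi>"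
  have hc: "integrable lborel (\<lambda>\<xi>. cis (x * \<xi>) * h \<xi>)" for x
    by (rule Bochner_Integration.integrable_bound[OF h]) (auto simp: norm_mult)
  have "(\<lambda>n. (?F (X n) - ?F x) /\<^sub>R (X n - x)) \<longlonglongrightarrow> (LINT \<xi>|lborel. cis (x * \<xi>) * (\<i> * (of_real \<xi> * h \<xi>)))"
    if X: "X \<longlonglongrightarrow> x" "\<And>n. X n \<noteq> x" for X
  proof -
    have "(?F (X n) - ?F x) /\<^sub>R (X n - x) = (LINT \<xi>|lborel. ((cis (X n * \<xi>) - cis (x * \<xi>)) /\<^sub>R (X n - x)) * h \<xi>)" for n
      by (subst Bochner_Integration.integral_diff[OF hc hc, symmetric])
         (simp add: left_diff_distrib[symmetric] flip: integral_scaleR_right)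
    moreover have "(\<lambda>n. LINT \<xi>|lborel. ((cis (X n * \<xi>) - cis (x * \<xi>)) /\<^sub>R (X n - x)) * h \<xi>)
        \<longlonglongrightarrow> (LINT \<xi>|lborel. cis (x * \<xi>) * (\<i> * (of_real \<xi> * h \<xi>)))"
    proof (rule integral_dominated_convergence)
      show "integrable lborel (\<lambda>\<xi>. cmod (of_real \<xi> * h \<xi>))" using h' by (rule integrable_norm)
      show "AE \<xi> in lborel. norm (((cis (X n * \<xi>) - cis (x * \<xi>)) /\<^sub>R (X n - x)) * h \<xi>) \<le> cmod (of_real \<xi> * h \<xi>)" for n
      proof (rule AE_I2)
        fix \<xi>
        have "cmod (cis (X n * \<xi>) - cis (x * \<xi>)) \<le> \<bar>X n - x\<bar> * \<bar>\<xi>\<bar>"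
          using norm_cis_diff_le[of "X n * \<xi>" "x * \<xi>"] by (simp add: abs_mult[symmetric] left_diff_distrib)
        then have "inverse \<bar>X n - x\<bar> * cmod (cis (X n * \<xi>) - cis (x * \<xi>)) \<le> \<bar>\<xi>\<bar>"
          using X(2)[of n] by (simp add: field_simps)
        then show "norm (((cis (X n * \<xi>) - cis (x * \<xi>)) /\<^sub>R (X n - x)) * h \<xi>) \<le> cmod (of_real \<xi> * h \<xi>)"
          using mult_right_mono[of _ _ "cmod (h \<xi>)"] by (fastforce simp: norm_mult)
      qed
      show "AE \<xi> in lborel. (\<lambda>n. ((cis (X n * \<xi>) - cis (x * \<xi>)) /\<^sub>R (X n - x)) * h \<xi>)
          \<longlonglongrightarrow> cis (x * \<xi>) * (\<i> * (of_real \<xi> * h \<xi>))"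
      proof (rule AE_I2)
        fix \<xi>
        have "((\<lambda>y. cos (y * \<xi>)) has_real_derivative - sin (x * \<xi>) * \<xi>) (at x)"
          and "((\<lambda>y. sin (y * \<xi>)) has_real_derivative cos (x * \<xi>) * \<xi>) (at x)"
          by (auto intro!: derivative_eq_intros)
        then have "((\<lambda>y. (cis (y * \<xi>) - cis (x * \<xi>)) /\<^sub>R (y - x)) \<longlongrightarrow> cis (x * \<xi>) * (\<i> * of_real \<xi>)) (at x)"
          unfolding has_field_derivative_iff tendsto_complex_iff by (simp add: divide_inverse mult.commute)
        then have "(\<lambda>n. (cis (X n * \<xi>) - cis (x * \<xi>)) /\<^sub>R (X n - x)) \<longlonglongrightarrow> cis (x * \<xi>) * (\<i> * of_real \<xi>)"
          using X unfolding LIMSEQ_SEQ_conv[symmetric] by blast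
        then have "(\<lambda>n. ((cis (X n * \<xi>) - cis (x * \<xi>)) /\<^sub>R (X n - x)) * h \<xi>) \<longlonglongrightarrow> (cis (x * \<xi>) * (\<i> * of_real \<xi>)) * h \<xi>"
          by (intro tendsto_mult tendsto_const)
        then show "(\<lambda>n. ((cis (X n * \<xi>) - cis (x * \<xi>)) /\<^sub>R (X n - x)) * h \<xi>)
          \<longlonglongrightarrow> cis (x * \<xi>) * (\<i> * (of_real \<xi> * h \<xi>))"
          by (simp only: mult.assoc)
      qed
    qed measurable
    ultimately show ?thesis by (simp only:)
  qed
  then have "((\<lambda>y. (?F y - ?F x) /\<^sub>R (y - x)) \<longlongrightarrow> (LINT \<xi>|lborel. cis (x * \<xi>) * (\<i> * (of_real \<xi> * h \<xi>)))) (at x)"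
    unfolding LIMSEQ_SEQ_conv[symmetric] by blast
  then show ?thesis .
qed


text \<open>
  The inversion formula bounds $f$ by the $L^1$ norm of its transform, which the weight controls.
\<close>
lemma sobolev_C0:
  assumes s: "1 / 2 < s" and f: "f \<in> sobolev s" and cont: "continuous_on UNIV f"
  shows "\<bar>f x\<bar> \<le> embedding_constant s * sobolev_norm s f"
proof -
  note S = sobolev_fourier_transform[OF f]
  note L = weighted_L2_imp_L1[OF s has_fourier_transformD(4)[OF S(1)] S(2)]
  have "2 * pi * \<bar>f x\<bar> = cmod (complex_of_real (2 * pi * f x))"
    by (simp add: norm_mult)
  also have "\<dots> \<le> embedding_constant s * sobolev_norm s f"
    unfolding fourier_inversion[OF S(1) cont L(1)] sobolev_norm_def
    using inverse_fourier_norm_le[OF L(1), of x] L(2) by linarith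
  finally have "2 * pi * \<bar>f x\<bar> \<le> embedding_constant s * sobolev_norm s f" .
  moreover have "1 * \<bar>f x\<bar> \<le> 2 * pi * \<bar>f x\<bar>"
    using pi_ge_two by (intro mult_right_mono) auto
  ultimately show ?thesis by linarith
qed

text \<open>
  Differentiation multiplies the transform by $i \xi$, and $|\xi|^2 (1 + \xi^2)^{s-1} \le (1 + \xi^2)^s$;
  so the preceding argument applies to the derivative with $s - 1$ in place of $s$.
\<close>
lemma sobolev_C1:
  assumes s: "3 / 2 < s" and f: "f \<in> sobolev s" and cont: "continuous_on UNIV f"
  shows "(f has_real_derivative deriv f x) (at x)"
    and "continuous_on UNIV (deriv f)"
    and "\<bar>deriv f x\<bar> \<le> embedding_constant (s - 1) * sobolev_norm s f"
proof -
  define g where "g = fourier_transform f"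
  define h where "h \<xi> = of_real \<xi> * g \<xi>" for \<xi>
  note S = sobolev_fourier_transform[OF f, folded g_def]
  have [measurable]: "g \<in> borel_measurable borel" by (rule has_fourier_transformD(4)[OF S(1)])
  have hm [measurable]: "h \<in> borel_measurable borel" unfolding h_def by measurable
  have "1 / 2 < s" "1 / 2 < s - 1" using s by auto
  note g1 = weighted_L2_imp_L1[OF this(1) has_fourier_transformD(4)[OF S(1)] S(2)]
  have hw: "(1 + \<xi>\<^sup>2) powr (s - 1) * (cmod (h \<xi>))\<^sup>2 \<le> (1 + \<xi>\<^sup>2) powr s * (cmod (g \<xi>))\<^sup>2" for \<xi>
  proof -
    have pos: "0 < 1 + \<xi>\<^sup>2" by (simp add: add_pos_nonneg)
    have "(1 + \<xi>\<^sup>2) powr (s - 1) * (cmod (h \<xi>))\<^sup>2 = (1 + \<xi>\<^sup>2) powr (s - 1) * \<xi>\<^sup>2 * (cmod (g \<xi>))\<^sup>2"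
      by (simp add: h_def norm_mult power_mult_distrib)
    also have "\<dots> \<le> (1 + \<xi>\<^sup>2) powr (s - 1) * (1 + \<xi>\<^sup>2) * (cmod (g \<xi>))\<^sup>2"
      by (intro mult_right_mono mult_left_mono) auto
    also have "(1 + \<xi>\<^sup>2) powr (s - 1) * (1 + \<xi>\<^sup>2) = (1 + \<xi>\<^sup>2) powr s"
      using pos by (simp add: powr_diff)
    finally show ?thesis .
  qed
  have hint: "integrable lborel (\<lambda>\<xi>. (1 + \<xi>\<^sup>2) powr (s - 1) * (cmod (h \<xi>))\<^sup>2)"
    by (rule Bochner_Integration.integrable_bound[OF S(2)]) (use hw in auto)
  note h1 = weighted_L2_imp_L1[OF \<open>1 / 2 < s - 1\<close> hm hint]
  define D where "D x = Re (LINT \<xi>|lborel. cis (x * \<xi>) * (\<i> * h \<xi>)) / (2 * pi)" for x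
  have ih: "integrable lborel (\<lambda>\<xi>. \<i> * h \<xi>)" using h1(1) by simp
  have f_eq: "f x = Re (LINT \<xi>|lborel. cis (x * \<xi>) * g \<xi>) / (2 * pi)" for x
    using fourier_inversion[OF S(1) cont g1(1), of x, symmetric] by simp
  have der: "(f has_real_derivative D x) (at x)" for x
  proof -
    have "((\<lambda>y. Re (((LINT \<xi>|lborel. cis (y * \<xi>) * g \<xi>) - (LINT \<xi>|lborel. cis (x * \<xi>) * g \<xi>)) /\<^sub>R (y - x)) / (2 * pi))
        \<longlongrightarrow> D x) (at x)"
      unfolding D_def h_def
      by (intro tendsto_divide tendsto_Re tendsto_const inverse_fourier_has_derivative g1(1) h1(1)[unfolded h_def]) simp
    then show ?thesis
      unfolding has_field_derivative_iff f_eq by (simp add: divide_simps mult.commute)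
  qed
  then have deriv: "deriv f = D" by (auto intro: DERIV_imp_deriv)
  show "(f has_real_derivative deriv f x) (at x)" using der deriv by simp
  show "continuous_on UNIV (deriv f)"
    unfolding deriv D_def using inverse_fourier_continuous[OF ih] by (intro continuous_intros) auto
  have "\<bar>D x\<bar> * (2 * pi) \<le> cmod (LINT \<xi>|lborel. cis (x * \<xi>) * (\<i> * h \<xi>))"
    using abs_Re_le_cmod[of "LINT \<xi>|lborel. cis (x * \<xi>) * (\<i> * h \<xi>)"] by (simp add: D_def abs_mult)
  also have "\<dots> \<le> (LINT \<xi>|lborel. cmod (h \<xi>))"
    using inverse_fourier_norm_le[OF ih, of x] by (simp add: norm_mult)
  also have "\<dots> \<le> embedding_constant (s - 1) * sqrt (LINT \<xi>|lborel. (1 + \<xi>\<^sup>2) powr (s - 1) * (cmod (h \<xi>))\<^sup>2)"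
    by (rule h1(2))
  also have "\<dots> \<le> embedding_constant (s - 1) * sobolev_norm s f"
    unfolding sobolev_norm_def g_def[symmetric]
    by (intro mult_left_mono real_sqrt_le_mono integral_mono hint S(2) hw)
       (simp add: embedding_constant_def integral_nonneg_AE)
  finally have "\<bar>D x\<bar> * (2 * pi) \<le> embedding_constant (s - 1) * sobolev_norm s f" .
  moreover have "\<bar>D x\<bar> * 1 \<le> \<bar>D x\<bar> * (2 * pi)"
    using pi_ge_two by (intro mult_left_mono) auto
  ultimately show "\<bar>deriv f x\<bar> \<le> embedding_constant (s - 1) * sobolev_norm s f"
    unfolding deriv by linarith
qed

section \<open>A maximum principle for transport equations with two-sided exponential weights\<close>

text \<open>
  The parameter $\delta > 0$ serves to make the weight unbounded at both ends; in applications it tends to $0$.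
\<close>
definition two_sided_weight :: "real \<Rightarrow> real \<Rightarrow> real \<Rightarrow> real" where
  "two_sided_weight \<theta> \<delta> x = exp (- \<theta> * x) + \<delta> * exp (\<theta> * x)"

lemma two_sided_weight_pos: "0 \<le> \<delta> \<Longrightarrow> 0 < two_sided_weight \<theta> \<delta> x"
  unfolding two_sided_weight_def by (intro add_pos_nonneg) auto

lemma exp_le_two_sided_weight: "0 \<le> \<delta> \<Longrightarrow> exp (- \<theta> * x) \<le> two_sided_weight \<theta> \<delta> x"
  unfolding two_sided_weight_def by simp

text \<open>
  The logarithm of the weight is Lipschitz with constant $\theta$.  For $\theta < 1$ this makes the
  weight admissible under convolution with $e^{-|x|}$.
\<close>
lemma two_sided_weight_translate:
  assumes "0 \<le> \<theta>" "0 \<le> \<delta>"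
  shows "two_sided_weight \<theta> \<delta> y \<le> exp (\<theta> * \<bar>x - y\<bar>) * two_sided_weight \<theta> \<delta> x"
proof -
  have "\<theta> * (x - y) \<le> \<theta> * \<bar>x - y\<bar>" "\<theta> * (y - x) \<le> \<theta> * \<bar>x - y\<bar>"
    using assms by (intro mult_left_mono; simp)+
  then have "exp (- \<theta> * y) \<le> exp (\<theta> * \<bar>x - y\<bar>) * exp (- \<theta> * x)"
    and "exp (\<theta> * y) \<le> exp (\<theta> * \<bar>x - y\<bar>) * exp (\<theta> * x)"
    by (simp_all add: exp_add[symmetric] algebra_simps)
  then show ?thesis
    using mult_left_mono[of "exp (\<theta> * y)" "exp (\<theta> * \<bar>x - y\<bar>) * exp (\<theta> * x)" \<delta>] assms(2)
    unfolding two_sided_weight_def by (simp add: algebra_simps)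
qed

text \<open>
  Any growth at both ends would do; it confines the maximum of a bounded function over the weight to a
  compact set.
\<close>
lemma two_sided_weight_linear_growth:
  assumes "0 \<le> \<theta>" "0 < \<delta>"
  shows "min 1 \<delta> * (\<theta> * \<bar>x\<bar>) \<le> two_sided_weight \<theta> \<delta> x"
proof -
  have "\<theta> * \<bar>x\<bar> \<le> exp (\<theta> * \<bar>x\<bar>)"
    using exp_ge_add_one_self[of "\<theta> * \<bar>x\<bar>"] by linarith
  then have "min 1 \<delta> * (\<theta> * \<bar>x\<bar>) \<le> min 1 \<delta> * exp (\<theta> * \<bar>x\<bar>)"
    using assms by (intro mult_left_mono) auto
  also have "\<dots> \<le> two_sided_weight \<theta> \<delta> x"
  proof (cases "0 \<le> x")
    case True
    have "min 1 \<delta> * exp (\<theta> * x) \<le> \<delta> * exp (\<theta> * x)" by (intro mult_right_mono) auto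
    also have "\<dots> \<le> two_sided_weight \<theta> \<delta> x" unfolding two_sided_weight_def by simp
    finally show ?thesis using True by simp
  next
    case False
    have "min 1 \<delta> * exp (- \<theta> * x) \<le> 1 * exp (- \<theta> * x)" by (intro mult_right_mono) auto
    also have "\<dots> \<le> two_sided_weight \<theta> \<delta> x"
      using assms unfolding two_sided_weight_def by simp
    finally show ?thesis using False by simp
  qed
  finally show ?thesis .
qed

lemma two_sided_weight_has_derivative:
  "(two_sided_weight \<theta> \<delta> has_real_derivative \<theta> * (\<delta> * exp (\<theta> * x) - exp (- \<theta> * x))) (at x)"
  unfolding two_sided_weight_def[abs_def]
  by (auto intro!: derivative_eq_intros simp: algebra_simps)

lemma two_sided_weight_continuous: "continuous_on A (two_sided_weight \<theta> \<delta>)"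
  unfolding two_sided_weight_def[abs_def] by (intro continuous_intros)

text \<open>
  The maximum principle for positive values of $w$; applied to $w$ and $-w$ it gives the two-sided form
  below.  The bound cannot fail: a violating value forces a maximum of $w e^{-Kt}/\omega$ above $B$ at
  some $t_0 > 0$, and there
  $K w \le w_t \le |a| |w_x| + c w + r e^{Kt} \omega \le (M + c) w + r e^{Kt} \omega$,
  because $w_x = w \omega'/\omega$ and $|\omega'| \le \omega$.
\<close>
lemma transport_upper_bound:
  fixes w wt wx a :: "real \<Rightarrow> real \<Rightarrow> real"
  assumes \<theta>: "0 < \<theta>" "\<theta> \<le> 1" and \<delta>: "0 < \<delta>" and K: "0 \<le> K"
    and cont: "continuous_on ({0..T} \<times> UNIV) (\<lambda>(t, x). w t x)"
    and bounded: "\<And>t x. t \<in> {0..T} \<Longrightarrow> \<bar>w t x\<bar> \<le> N"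
    and dt: "\<And>t x. t \<in> {0..T} \<Longrightarrow> ((\<lambda>\<tau>. w \<tau> x) has_real_derivative wt t x) (at t within {0..T})"
    and dx: "\<And>t x. t \<in> {0..T} \<Longrightarrow> (w t has_real_derivative wx t x) (at x)"
    and speed: "\<And>t x. t \<in> {0..T} \<Longrightarrow> \<bar>a t x\<bar> \<le> M"
    and eqn: "\<And>t x. t \<in> {0..T} \<Longrightarrow>
        \<bar>wt t x + a t x * wx t x\<bar> \<le> c * \<bar>w t x\<bar> + r * (exp (K * t) * two_sided_weight \<theta> \<delta> x)"
    and init: "\<And>x. \<bar>w 0 x\<bar> \<le> B * two_sided_weight \<theta> \<delta> x"
    and gap: "M + c < K" "r \<le> (K - M - c) * B"
    and t: "t \<in> {0..T}"
  shows "w t x \<le> B * (exp (K * t) * two_sided_weight \<theta> \<delta> x)"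
proof (rule ccontr)
  let ?\<omega> = "two_sided_weight \<theta> \<delta>"
  define f where "f t x = w t x * exp (- K * t) / ?\<omega> x" for t x
  have \<omega>pos: "0 < ?\<omega> x" for x using two_sided_weight_pos[of \<delta>] \<delta> by simp
  assume "\<not> ?thesis"
  then have "B < f t x"
    using \<omega>pos[of x] by (simp add: f_def field_simps exp_minus)
  moreover have "0 \<le> B"
    using init[of 0] \<omega>pos[of 0] by (smt (verit) mult_neg_pos)
  ultimately have fpos: "0 < f t x" by simp
  have "0 \<le> N" using bounded[OF t, of x] by linarith
  \<comment> \<open>Beyond this radius the linear growth of the weight forces the quotient below its value at the violating point.\<close>
  define \<rho> where "\<rho> = max \<bar>x\<bar> (N / (f t x * (min 1 \<delta> * \<theta>)))"
  have md: "0 < min 1 \<delta> * \<theta>" using \<theta> \<delta> by simp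
  have outside: "f s y \<le> f t x" if s: "s \<in> {0..T}" and y: "\<rho> \<le> \<bar>y\<bar>" for s y
  proof -
    have "N / (f t x * (min 1 \<delta> * \<theta>)) \<le> \<bar>y\<bar>" using y by (simp add: \<rho>_def)
    then have "N \<le> f t x * (min 1 \<delta> * (\<theta> * \<bar>y\<bar>))"
      using fpos md by (subst (asm) pos_divide_le_eq[OF mult_pos_pos]) (simp_all add: mult_ac)
    also have "\<dots> \<le> f t x * ?\<omega> y"
      using fpos two_sided_weight_linear_growth[of \<theta> \<delta> y] \<theta> \<delta> by (intro mult_left_mono) auto
    finally have "N \<le> f t x * ?\<omega> y" .
    moreover have "w s y * exp (- K * s) \<le> N"
    proof -
      have "w s y * exp (- K * s) \<le> N * exp (- K * s)"
        using bounded[OF s, of y] by (intro mult_right_mono) auto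
      also have "\<dots> \<le> N * 1"
        using K s \<open>0 \<le> N\<close> by (intro mult_left_mono) auto
      finally show ?thesis by simp
    qed
    ultimately show ?thesis
      using \<omega>pos[of y] by (simp add: f_def[of s y] pos_divide_le_eq)
  qed
  have "continuous_on ({0..T} \<times> UNIV) (\<lambda>p. f (fst p) (snd p))"
  proof -
    have "continuous_on ({0..T} \<times> UNIV) (\<lambda>p::real\<times>real. ?\<omega> (snd p))"
      by (rule continuous_on_compose2[OF two_sided_weight_continuous[of UNIV]])
         (auto intro: continuous_intros)
    then show ?thesis
      unfolding f_def using cont \<omega>pos
      by (intro continuous_intros) (auto simp: case_prod_beta less_imp_neq[THEN not_sym])
  qed
  then have "continuous_on ({0..T} \<times> {- \<rho>..\<rho>}) (\<lambda>p. f (fst p) (snd p))"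
    by (rule continuous_on_subset) auto
  moreover have "(t, x) \<in> {0..T} \<times> {- \<rho>..\<rho>}" using t by (auto simp: \<rho>_def)
  ultimately have "\<exists>p \<in> {0..T} \<times> {- \<rho>..\<rho>}. \<forall>q \<in> {0..T} \<times> {- \<rho>..\<rho>}.
      f (fst q) (snd q) \<le> f (fst p) (snd p)"
    by (intro continuous_attains_sup compact_Times compact_Icc) auto
  then obtain p where p: "p \<in> {0..T} \<times> {- \<rho>..\<rho>}"
    and pmax: "\<And>q. q \<in> {0..T} \<times> {- \<rho>..\<rho>} \<Longrightarrow> f (fst q) (snd q) \<le> f (fst p) (snd p)"
    by blast
  define t0 x0 where "t0 = fst p" and "x0 = snd p"
  have t0: "t0 \<in> {0..T}" using p by (auto simp: t0_def)
  have "f t x \<le> f t0 x0"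
    using pmax[of "(t, x)"] \<open>(t, x) \<in> _\<close> by (simp add: t0_def x0_def)
  then have max0: "f s y \<le> f t0 x0" if "s \<in> {0..T}" for s y
    using pmax[of "(s, y)"] outside[OF that, of y] that
    by (cases "\<rho> \<le> \<bar>y\<bar>") (force simp: t0_def x0_def abs_le_iff)+
  have B0: "B < f t0 x0" using \<open>f t x \<le> f t0 x0\<close> \<open>B < f t x\<close> by simp
  have wpos: "0 < w t0 x0"
  proof -
    have "0 < w t0 x0 * exp (- K * t0) / ?\<omega> x0"
      using B0 \<open>0 \<le> B\<close> by (simp add: f_def)
    then show ?thesis using \<omega>pos[of x0] by (simp add: zero_less_divide_iff zero_less_mult_iff)
  qed
  have "t0 \<noteq> 0"
  proof
    assume "t0 = 0"
    then have "f t0 x0 \<le> B"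
      using init[of x0] \<omega>pos[of x0] by (simp add: f_def pos_divide_le_eq)
    with B0 show False by simp
  qed
  then have "0 < t0" using t0 by simp
  define D where "D = \<theta> * (\<delta> * exp (\<theta> * x0) - exp (- \<theta> * x0))"
  have "(wx t0 x0 * ?\<omega> x0 - w t0 x0 * D) / (?\<omega> x0 * ?\<omega> x0) = 0"
  proof (rule DERIV_local_max[of "\<lambda>y. w t0 y / ?\<omega> y" _ x0 1])
    show "((\<lambda>y. w t0 y / ?\<omega> y) has_real_derivative
        (wx t0 x0 * ?\<omega> x0 - w t0 x0 * D) / (?\<omega> x0 * ?\<omega> x0)) (at x0)"
      using \<omega>pos[of x0] unfolding D_def
      by (intro DERIV_divide dx[OF t0] two_sided_weight_has_derivative) simp
    show "\<forall>y. \<bar>x0 - y\<bar> < 1 \<longrightarrow> w t0 y / ?\<omega> y \<le> w t0 x0 / ?\<omega> x0"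
    proof (intro allI impI)
      fix y
      have "w t0 y / ?\<omega> y * exp (- K * t0) \<le> w t0 x0 / ?\<omega> x0 * exp (- K * t0)"
        using max0[OF t0, of y] by (simp add: f_def)
      then show "w t0 y / ?\<omega> y \<le> w t0 x0 / ?\<omega> x0"
        by (rule mult_right_le_imp_le) simp
    qed
  qed simp
  then have "wx t0 x0 * ?\<omega> x0 = w t0 x0 * D"
    using \<omega>pos[of x0] by simp
  moreover have "\<bar>D\<bar> \<le> ?\<omega> x0"
  proof -
    have "\<bar>D\<bar> = \<theta> * \<bar>\<delta> * exp (\<theta> * x0) - exp (- \<theta> * x0)\<bar>"
      using \<theta> by (simp add: D_def abs_mult)
    also have "\<dots> \<le> 1 * (\<bar>\<delta> * exp (\<theta> * x0)\<bar> + \<bar>exp (- \<theta> * x0)\<bar>)"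
      using \<theta> by (intro mult_mono abs_triangle_ineq4) auto
    finally show ?thesis using \<delta> by (simp add: two_sided_weight_def)
  qed
  ultimately have "\<bar>wx t0 x0\<bar> * ?\<omega> x0 \<le> w t0 x0 * ?\<omega> x0"
    using wpos \<omega>pos[of x0] mult_left_mono[of "\<bar>D\<bar>" "?\<omega> x0" "w t0 x0"]
    by (metis abs_mult abs_of_pos less_imp_le)
  then have wx: "\<bar>wx t0 x0\<bar> \<le> w t0 x0" using \<omega>pos[of x0] by simp
  have "0 \<le> wt t0 x0 * exp (- K * t0) - K * exp (- K * t0) * w t0 x0"
  proof (rule ccontr)
    assume neg: "\<not> ?thesis"
    let ?g = "\<lambda>\<tau>. w \<tau> x0 * exp (- K * \<tau>)"
    have "(?g has_real_derivative wt t0 x0 * exp (- K * t0) - K * exp (- K * t0) * w t0 x0)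
        (at t0 within {0..T})"
      by (rule derivative_eq_intros dt[OF t0] refl)+ simp
    then have "\<exists>d>0. \<forall>h>0. t0 - h \<in> {0..T} \<longrightarrow> h < d \<longrightarrow> ?g t0 < ?g (t0 - h)"
      using neg unfolding not_le by (rule has_real_derivative_neg_dec_left)
    then obtain d where "0 < d" and d: "\<And>h. 0 < h \<Longrightarrow> t0 - h \<in> {0..T} \<Longrightarrow> h < d \<Longrightarrow> ?g t0 < ?g (t0 - h)"
      by blast
    define h where "h = min (d / 2) t0"
    have "?g t0 < ?g (t0 - h)"
      using \<open>0 < t0\<close> \<open>0 < d\<close> t0 by (intro d) (auto simp: h_def)
    moreover have "f (t0 - h) x0 \<le> f t0 x0"
      using \<open>0 < t0\<close> \<open>0 < d\<close> t0 by (intro max0) (auto simp: h_def)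
    ultimately show False
      using \<omega>pos[of x0] by (simp add: f_def divide_le_cancel)
  qed
  then have "0 \<le> exp (- K * t0) * (wt t0 x0 - K * w t0 x0)"
    by (simp add: algebra_simps)
  then have "K * w t0 x0 \<le> wt t0 x0"
    by (simp add: zero_le_mult_iff)
  also have "\<dots> \<le> \<bar>a t0 x0\<bar> * \<bar>wx t0 x0\<bar> + c * w t0 x0 + r * (exp (K * t0) * ?\<omega> x0)"
    using eqn[OF t0, of x0] wpos by (simp add: abs_mult[symmetric])
  also have "\<dots> \<le> M * w t0 x0 + c * w t0 x0 + r * (exp (K * t0) * ?\<omega> x0)"
    using speed[OF t0, of x0] wx by (intro add_right_mono mult_mono) auto
  finally have "(K - M - c) * w t0 x0 \<le> r * (exp (K * t0) * ?\<omega> x0)"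
    by (simp add: algebra_simps)
  also have "\<dots> \<le> (K - M - c) * B * (exp (K * t0) * ?\<omega> x0)"
    using gap \<omega>pos[of x0] by (intro mult_right_mono) auto
  finally have "w t0 x0 \<le> B * (exp (K * t0) * ?\<omega> x0)"
    using gap(1) by (simp add: mult.assoc)
  then have "f t0 x0 \<le> B"
    using \<omega>pos[of x0] by (simp add: f_def field_simps exp_minus)
  with B0 show False by simp
qed

lemma transport_maximum_principle:
  fixes w wt wx a :: "real \<Rightarrow> real \<Rightarrow> real"
  assumes \<theta>: "0 < \<theta>" "\<theta> \<le> 1" and \<delta>: "0 < \<delta>" and K: "0 \<le> K"
    and cont: "continuous_on ({0..T} \<times> UNIV) (\<lambda>(t, x). w t x)"
    and bounded: "\<And>t x. t \<in> {0..T} \<Longrightarrow> \<bar>w t x\<bar> \<le> N"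
    and dt: "\<And>t x. t \<in> {0..T} \<Longrightarrow> ((\<lambda>\<tau>. w \<tau> x) has_real_derivative wt t x) (at t within {0..T})"
    and dx: "\<And>t x. t \<in> {0..T} \<Longrightarrow> (w t has_real_derivative wx t x) (at x)"
    and speed: "\<And>t x. t \<in> {0..T} \<Longrightarrow> \<bar>a t x\<bar> \<le> M"
    and eqn: "\<And>t x. t \<in> {0..T} \<Longrightarrow>
        \<bar>wt t x + a t x * wx t x\<bar> \<le> c * \<bar>w t x\<bar> + r * (exp (K * t) * two_sided_weight \<theta> \<delta> x)"
    and init: "\<And>x. \<bar>w 0 x\<bar> \<le> B * two_sided_weight \<theta> \<delta> x"
    and gap: "M + c < K" "r \<le> (K - M - c) * B"
    and t: "t \<in> {0..T}"
  shows "\<bar>w t x\<bar> \<le> B * (exp (K * t) * two_sided_weight \<theta> \<delta> x)"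
proof -
  have "w t x \<le> B * (exp (K * t) * two_sided_weight \<theta> \<delta> x)"
    by (rule transport_upper_bound[OF \<theta> \<delta> K cont bounded dt dx speed eqn init gap t])
  moreover have "- w t x \<le> B * (exp (K * t) * two_sided_weight \<theta> \<delta> x)"
  proof (rule transport_upper_bound[OF \<theta> \<delta> K, where w = "\<lambda>t x. - w t x" and wt = "\<lambda>t x. - wt t x"
        and wx = "\<lambda>t x. - wx t x" and a = a and N = N and T = T and M = M and c = c and r = r])
    show "continuous_on ({0..T} \<times> UNIV) (\<lambda>(t, x). - w t x)"
      using continuous_on_minus[OF cont] by (simp add: case_prod_beta)
    show "\<bar>- wt t x + a t x * - wx t x\<bar>
        \<le> c * \<bar>- w t x\<bar> + r * (exp (K * t) * two_sided_weight \<theta> \<delta> x)" if "t \<in> {0..T}" for t x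
      using eqn[OF that, of x] by (simp add: abs_le_iff)
  qed (use bounded speed init gap t in \<open>auto intro!: dt dx DERIV_minus\<close>)
  ultimately show ?thesis by (simp add: abs_le_iff)
qed

section \<open>Convolution with the derivative of the kernel\<close>

lemma exp_abs_integral:
  fixes k c :: real
  assumes "0 < k"
  shows "integrable lborel (\<lambda>y. exp (- k * \<bar>y - c\<bar>))" (is ?int)
    and "(LINT y|lborel. exp (- k * \<bar>y - c\<bar>)) = 2 / k" (is ?eq)
proof -
  have 1: "has_bochner_integral lborel (\<lambda>y. indicator {0..} y * exp (- k * y)) (1 / k)"
  proof (rule has_bochner_integral_nn_integral)
    have "(\<integral>\<^sup>+ y. ennreal (exp (- k * y)) * indicator {0..} y \<partial>lborel) = 0 - (- exp (- k * 0) / k)"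
    proof (rule nn_integral_FTC_atLeast)
      show "((\<lambda>y. - exp (- k * y) / k) \<longlongrightarrow> 0) at_top"
      proof -
        have "LIM y at_top. - k * y :> at_bot"
          using assms by (intro filterlim_tendsto_neg_mult_at_bot[OF tendsto_const] filterlim_ident) auto
        then have "((\<lambda>y. exp (- k * y)) \<longlongrightarrow> 0) at_top"
          by (rule filterlim_compose[OF exp_at_bot])
        then show ?thesis using tendsto_divide[OF tendsto_minus tendsto_const, of "\<lambda>y. exp (- k * y)" 0 at_top k] assms by simp
      qed
      show "((\<lambda>y. - exp (- k * y) / k) has_real_derivative exp (- k * x)) (at x)" for x
        using assms by (auto intro!: derivative_eq_intros)
    qed auto
    then show "(\<integral>\<^sup>+ y. ennreal (indicator {0..} y * exp (- k * y)) \<partial>lborel) = ennreal (1 / k)"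
      by (simp add: ennreal_mult' ennreal_indicator mult.commute)
  qed (use assms in auto)
  have "has_bochner_integral lborel (\<lambda>y. exp (- k * \<bar>y\<bar>)) (2 / k)"
    using has_bochner_integral_abs[OF 1] by simp
  then have "has_bochner_integral lborel (\<lambda>y. exp (- k * \<bar>y - c\<bar>)) (2 / k)"
    using lborel_has_bochner_integral_real_affine_iff[of 1 "\<lambda>y. exp (- k * \<bar>y\<bar>)" "2/k" "-c"]
    by (simp add: add.commute)
  then show ?int ?eq by (simp_all add: has_bochner_integral_iff)
qed

text \<open>
  The excluded origin is a null set for every convolution below.
\<close>
lemma deriv_G:
  assumes "z \<noteq> 0"
  shows "deriv G z = - sgn z / 2 * exp (- \<bar>z\<bar>)"
proof -
  have "(G has_real_derivative - sgn z / 2 * exp (- \<bar>z\<bar>)) (at z)"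
  proof (cases "0 < z")
    case True
    have "((\<lambda>z. 1 / 2 * exp (- z)) has_real_derivative - sgn z / 2 * exp (- \<bar>z\<bar>)) (at z)"
      using True by (auto intro!: derivative_eq_intros)
    then show ?thesis
      by (rule has_field_derivative_transform_within_open[where S = "{0<..}"]) (use True in \<open>auto simp: G_def\<close>)
  next
    case False
    have "((\<lambda>z. 1 / 2 * exp z) has_real_derivative - sgn z / 2 * exp (- \<bar>z\<bar>)) (at z)"
      using False assms by (auto intro!: derivative_eq_intros)
    then show ?thesis
      by (rule has_field_derivative_transform_within_open[where S = "{..<0}"]) (use False assms in \<open>auto simp: G_def\<close>)
  qed
  then show ?thesis by (rule DERIV_imp_deriv)
qed

lemma borel_measurable_deriv_G [measurable]: "deriv G \<in> borel_measurable borel"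
proof -
  have "deriv G = (\<lambda>z. if z = 0 then deriv G 0 else - sgn z / 2 * exp (- \<bar>z\<bar>))"
    by (auto simp: deriv_G)
  also have "\<dots> \<in> borel_measurable borel" by measurable
  finally show ?thesis .
qed

text \<open>
  The comparison function may be centred at the evaluation point (to propagate a weight) or at the
  origin (to extract the decay of the kernel); both occur, hence the free centre $c$.
\<close>
lemma convolution_deriv_G_bound:
  fixes F :: "real \<Rightarrow> real"
  assumes k: "0 < k" and F[measurable]: "F \<in> borel_measurable borel"
    and bound: "\<And>y. exp (- \<bar>x - y\<bar>) * \<bar>F y\<bar> \<le> A * exp (- k * \<bar>y - c\<bar>)"
  shows "integrable lborel (\<lambda>y. deriv G (x - y) * F y)" (is ?int)
    and "\<bar>Defs.convolution (deriv G) F x\<bar> \<le> A / k" (is ?le)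
proof -
  have "AE y in lborel. y \<noteq> x" by (rule AE_lborel_singleton)
  then have ae: "AE y in lborel. norm (deriv G (x - y) * F y) \<le> A / 2 * exp (- k * \<bar>y - c\<bar>)"
  proof eventually_elim
    case (elim y)
    then have "norm (deriv G (x - y) * F y) = (exp (- \<bar>x - y\<bar>) * \<bar>F y\<bar>) / 2"
      by (auto simp: deriv_G abs_mult sgn_if)
    also have "\<dots> \<le> A * exp (- k * \<bar>y - c\<bar>) / 2"
      by (intro divide_right_mono bound) simp
    finally show ?case by simp
  qed
  have int: "integrable lborel (\<lambda>y. A / 2 * exp (- k * \<bar>y - c\<bar>))"
    using exp_abs_integral(1)[OF k] by (intro integrable_mult_right)
  show ?int
  proof (rule Bochner_Integration.integrable_bound[OF int])
    show "AE y in lborel. norm (deriv G (x - y) * F y) \<le> norm (A / 2 * exp (- k * \<bar>y - c\<bar>))"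
      using ae by eventually_elim (metis abs_ge_self order_trans real_norm_def)
  qed measurable
  have "\<bar>Defs.convolution (deriv G) F x\<bar> \<le> (LINT y|lborel. A / 2 * exp (- k * \<bar>y - c\<bar>))"
    using integral_norm_bound_AE[OF int ae] by (simp add: Defs.convolution_def)
  also have "\<dots> = A / k" using exp_abs_integral(2)[OF k, of c] by simp
  finally show ?le .
qed

text \<open>
  Away from the jump of $G'$ at the origin the increment is of size $h e^{-|p|}$; across the jump, which
  happens only for $p$ in an interval of length $h$, it is at most $1$.
\<close>
lemma deriv_G_increment:
  assumes h: "0 \<le> h" "h \<le> 1" and p: "p \<noteq> 0" "p + h \<noteq> 0"
  shows "\<bar>deriv G (p + h) - deriv G p\<bar> \<le> h * (exp 1 * exp (- \<bar>p\<bar>)) / 2 + indicator {-h..0} p"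
proof (cases "p < 0 \<and> 0 < p + h")
  case True
  have "deriv G (p + h) = - exp (- (p + h)) / 2" "deriv G p = exp p / 2"
    using True by (simp_all add: deriv_G)
  moreover have "exp (- (p + h)) \<le> 1" "exp p \<le> 1" using True by auto
  moreover have "0 \<le> h * (exp 1 * exp (- \<bar>p\<bar>)) / 2" using h by simp
  moreover have "indicator {-h..0} p = (1::real)" using True by auto
  ultimately show ?thesis
    using exp_gt_zero[of "- (p + h)"] exp_gt_zero[of p] by linarith
next
  case False
  have eh: "exp h - 1 \<le> h * exp 1"
  proof -
    have "1 - h \<le> exp (- h)" using exp_ge_add_one_self[of "-h"] by simp
    then have "exp h * (1 - h) \<le> exp h * exp (- h)" by (intro mult_left_mono) auto
    then have "exp h - 1 \<le> h * exp h" by (simp add: exp_minus algebra_simps)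
    also have "\<dots> \<le> h * exp 1" using h by (intro mult_left_mono) auto
    finally show ?thesis .
  qed
  have eh': "1 - exp (- h) \<le> h * exp 1"
  proof -
    have "1 - exp (- h) \<le> h" using exp_ge_add_one_self[of "-h"] by simp
    also have "\<dots> \<le> h * exp 1" using h by (simp add: mult_le_cancel_left1)
    finally show ?thesis .
  qed
  have "\<bar>deriv G (p + h) - deriv G p\<bar> \<le> h * (exp 1 * exp (- \<bar>p\<bar>)) / 2"
  proof (cases "0 < p")
    case True
    then have "\<bar>deriv G (p + h) - deriv G p\<bar> = exp (- p) * (1 - exp (- h)) / 2"
      using h by (simp add: deriv_G algebra_simps exp_add[symmetric] exp_diff abs_of_nonneg) (simp add: exp_minus field_simps)
    also have "\<dots> \<le> exp (- p) * (h * exp 1) / 2"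
      using eh' by (intro divide_right_mono mult_left_mono) auto
    finally show ?thesis using True by (simp add: mult_ac)
  next
    case neg: False
    then have "p < 0" "p + h < 0" using False p by auto
    then have "\<bar>deriv G (p + h) - deriv G p\<bar> = exp p * (exp h - 1) / 2"
      using h by (simp add: deriv_G exp_add algebra_simps)
    also have "\<dots> \<le> exp p * (h * exp 1) / 2"
      using eh by (intro divide_right_mono mult_left_mono) auto
    finally show ?thesis using \<open>p < 0\<close> by (simp add: mult_ac)
  qed
  moreover have "0 \<le> (indicator {-h..0} p :: real)" by simp
  ultimately show ?thesis by linarith
qed

text \<open>
  The convolution is Lipschitz although $G'$ jumps, since the jump is integrated over an interval of
  length $h$.  The Lipschitz constant is local and proportional to $A$, the size of $F$ near $x$ measured by an
  exponential of rate less than $1$; so weighted bounds on $F$ pass to difference quotients.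
\<close>
lemma convolution_deriv_G_increment:
  fixes F :: "real \<Rightarrow> real"
  assumes \<theta>: "0 \<le> \<theta>" "\<theta> < 1" and F[measurable]: "F \<in> borel_measurable borel"
    and bound: "\<And>y. \<bar>F y\<bar> \<le> A * exp (\<theta> * \<bar>x - y\<bar>)"
    and h: "0 \<le> h" "h \<le> 1"
  shows "\<bar>Defs.convolution (deriv G) F (x + h) - Defs.convolution (deriv G) F x\<bar>
           \<le> h * (exp 1 * (1 / (1 - \<theta>) + 1) * A)"
proof -
  have A: "0 \<le> A" using bound[of x] by simp
  have b1: "exp (- \<bar>x - y\<bar>) * \<bar>F y\<bar> \<le> A * exp (- (1 - \<theta>) * \<bar>y - x\<bar>)" for y
  proof -
    have "exp (- \<bar>x - y\<bar>) * \<bar>F y\<bar> \<le> exp (- \<bar>x - y\<bar>) * (A * exp (\<theta> * \<bar>x - y\<bar>))"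
      by (intro mult_left_mono bound) simp
    also have "\<dots> = A * exp (- (1 - \<theta>) * \<bar>y - x\<bar>)"
      by (simp add: exp_add[symmetric] abs_minus_commute algebra_simps)
    finally show ?thesis .
  qed
  have b2: "exp (- \<bar>x + h - y\<bar>) * \<bar>F y\<bar> \<le> (exp 1 * A) * exp (- (1 - \<theta>) * \<bar>y - x\<bar>)" for y
  proof -
    have "exp (- \<bar>x + h - y\<bar>) \<le> exp 1 * exp (- \<bar>x - y\<bar>)"
      using h by (simp add: exp_add[symmetric])
    then have "exp (- \<bar>x + h - y\<bar>) * \<bar>F y\<bar> \<le> exp 1 * (exp (- \<bar>x - y\<bar>) * \<bar>F y\<bar>)"
      using mult_right_mono[of "exp (- \<bar>x + h - y\<bar>)" "exp 1 * exp (- \<bar>x - y\<bar>)" "\<bar>F y\<bar>"]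
      by (simp add: mult.assoc)
    also have "\<dots> \<le> exp 1 * (A * exp (- (1 - \<theta>) * \<bar>y - x\<bar>))"
      by (intro mult_left_mono b1) simp
    finally show ?thesis by (simp add: mult.assoc)
  qed
  have k: "0 < 1 - \<theta>" using \<theta> by simp
  note int1 = convolution_deriv_G_bound(1)[OF k F b1]
  note int2 = convolution_deriv_G_bound(1)[OF k F b2]
  let ?g = "\<lambda>y. h * exp 1 * A / 2 * exp (- (1 - \<theta>) * \<bar>y - x\<bar>) + exp 1 * A * indicator {x..x+h} y"
  have "AE y in lborel. y \<noteq> x" "AE y in lborel. y \<noteq> x + h" by (rule AE_lborel_singleton)+
  then have ae: "AE y in lborel. norm (deriv G (x + h - y) * F y - deriv G (x - y) * F y) \<le> ?g y"
  proof eventually_elim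
    case (elim y)
    have "norm (deriv G (x + h - y) * F y - deriv G (x - y) * F y)
        = \<bar>deriv G ((x - y) + h) - deriv G (x - y)\<bar> * \<bar>F y\<bar>"
      by (simp add: abs_mult[symmetric] algebra_simps)
    also have "\<dots> \<le> (h * (exp 1 * exp (- \<bar>x - y\<bar>)) / 2 + indicator {-h..0} (x - y)) * \<bar>F y\<bar>"
      using elim by (intro mult_right_mono deriv_G_increment h) auto
    also have "\<dots> = h * exp 1 / 2 * (exp (- \<bar>x - y\<bar>) * \<bar>F y\<bar>) + indicator {-h..0} (x - y) * \<bar>F y\<bar>"
      by (simp add: algebra_simps)
    also have "\<dots> \<le> h * exp 1 / 2 * (A * exp (- (1 - \<theta>) * \<bar>y - x\<bar>)) + indicator {x..x+h} y * (exp 1 * A)"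
    proof (intro add_mono mult_left_mono b1)
      show "indicator {-h..0} (x - y) * \<bar>F y\<bar> \<le> indicator {x..x+h} y * (exp 1 * A)"
      proof (cases "y \<in> {x..x+h}")
        case True
        have "\<theta> * \<bar>x - y\<bar> \<le> 1 * 1" using True \<theta> h by (intro mult_mono) auto
        then have "A * exp (\<theta> * \<bar>x - y\<bar>) \<le> A * exp 1" using A by (intro mult_left_mono) auto
        with bound[of y] True show ?thesis by (auto simp: indicator_def mult.commute)
      next
        case False
        then show ?thesis by (auto simp: indicator_def)
      qed
    qed (use h in auto)
    finally show ?case by (simp add: mult_ac)
  qed
  have intg: "integrable lborel ?g"
    using exp_abs_integral(1)[OF k] by (intro Bochner_Integration.integrable_add integrable_mult_right)
       (auto intro!: integrable_real_indicator simp: emeasure_lborel_Icc_eq)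
  have "\<bar>Defs.convolution (deriv G) F (x + h) - Defs.convolution (deriv G) F x\<bar>
      = norm (LINT y|lborel. deriv G (x + h - y) * F y - deriv G (x - y) * F y)"
    unfolding Defs.convolution_def by (subst Bochner_Integration.integral_diff[OF int2 int1]) simp
  also have "\<dots> \<le> (LINT y|lborel. ?g y)"
    by (rule integral_norm_bound_AE[OF intg ae])
  also have "\<dots> = h * exp 1 * A / 2 * (2 / (1 - \<theta>)) + exp 1 * A * h"
  proof -
    have "(LINT y|lborel. ?g y) = (LINT y|lborel. h * exp 1 * A / 2 * exp (- (1 - \<theta>) * \<bar>y - x\<bar>))
        + (LINT y|lborel. exp 1 * A * indicator {x..x+h} y)"
      using exp_abs_integral(1)[OF k]
      by (intro Bochner_Integration.integral_add integrable_mult_right)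
         (auto intro!: integrable_real_indicator simp: emeasure_lborel_Icc_eq)
    also have "(LINT y|lborel. h * exp 1 * A / 2 * exp (- (1 - \<theta>) * \<bar>y - x\<bar>))
        = h * exp 1 * A / 2 * (2 / (1 - \<theta>))"
      using exp_abs_integral(2)[OF k, of x] by (metis integral_mult_right_zero)
    also have "(LINT y|lborel. exp 1 * A * indicator {x..x+h} y) = exp 1 * A * h"
      using h by simp
    finally show ?thesis .
  qed
  also have "\<dots> = h * (exp 1 * (1 / (1 - \<theta>) + 1) * A)"
  proof -
    have "h * exp 1 * A / 2 * (2 / (1 - \<theta>)) = h * exp 1 * A * (1 / (1 - \<theta>))" by simp
    then show ?thesis by (simp only: algebra_simps)
  qed
  finally show ?thesis .
qed

lemma convolution_deriv_G_continuous:
  fixes F :: "real \<Rightarrow> real"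
  assumes F: "F \<in> borel_measurable borel" and bound: "\<And>y. \<bar>F y\<bar> \<le> A"
  shows "continuous_on UNIV (Defs.convolution (deriv G) F)"
proof (rule continuous_at_imp_continuous_on, intro ballI)
  fix x
  let ?P = "Defs.convolution (deriv G) F"
  let ?L = "exp 1 * 2 * A"
  have inc: "\<bar>?P (z + h) - ?P z\<bar> \<le> h * ?L" if "0 \<le> h" "h \<le> 1" for z h
    using convolution_deriv_G_increment[of 0 F A z h] that F bound by simp
  have "\<forall>\<^sub>F y in at x. norm (?P y - ?P x) \<le> \<bar>y - x\<bar> * ?L"
    unfolding eventually_at
  proof (intro exI[of _ 1] conjI ballI impI)
    fix y assume y: "y \<noteq> x \<and> dist y x < 1"
    show "norm (?P y - ?P x) \<le> \<bar>y - x\<bar> * ?L"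
    proof (cases "x \<le> y")
      case True
      then show ?thesis using inc[of "y - x" x] y by (simp add: dist_real_def)
    next
      case False
      then show ?thesis using inc[of "x - y" y] y by (simp add: dist_real_def abs_minus_commute)
    qed
  qed simp
  moreover have "((\<lambda>y. \<bar>y - x\<bar> * ?L) \<longlongrightarrow> 0) (at x)"
    by (auto intro!: tendsto_eq_intros)
  ultimately have "((\<lambda>y. ?P y - ?P x) \<longlongrightarrow> 0) (at x)"
    by (rule Lim_null_comparison)
  then show "isCont ?P x" unfolding isCont_def by (simp add: LIM_zero_iff)
qed

section \<open>Classical regularity of strong solutions\<close>

definition CH_source :: "(real \<Rightarrow> real) \<Rightarrow> real \<Rightarrow> real" where
  "CH_source f y = (f y)\<^sup>2 + 1 / 2 * (deriv f y)\<^sup>2"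

lemma sobolev_norm_nonneg: "0 \<le> sobolev_norm s f"
  unfolding sobolev_norm_def by (auto intro!: integral_nonneg_AE)

text \<open>
  One factor of each square is estimated by the a priori bound $M$, the other by the quantity $L$ to be
  propagated; this makes the quadratic source linear in $L$.
\<close>
lemma CH_source_bound:
  assumes "\<bar>f y\<bar> \<le> M" "\<bar>deriv f y\<bar> \<le> M" "\<bar>f y\<bar> \<le> L" "\<bar>deriv f y\<bar> \<le> L"
  shows "\<bar>CH_source f y\<bar> \<le> 2 * (M * L)"
proof -
  have "0 \<le> M" using assms(1) by linarith
  then have "\<bar>f y\<bar> * \<bar>f y\<bar> \<le> M * L" "\<bar>deriv f y\<bar> * \<bar>deriv f y\<bar> \<le> M * L"
    using assms by (intro mult_mono; simp)+
  then have "(f y)\<^sup>2 \<le> M * L" "(deriv f y)\<^sup>2 \<le> M * L"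
    by (simp_all add: power2_eq_square)
  moreover have "0 \<le> (f y)\<^sup>2" "0 \<le> (deriv f y)\<^sup>2" by simp_all
  ultimately show ?thesis unfolding CH_source_def by linarith
qed

lemma CH_source_measurable:
  assumes "continuous_on UNIV f" "continuous_on UNIV (deriv f)"
  shows "CH_source f \<in> borel_measurable borel"
  unfolding CH_source_def[abs_def]
  by (intro borel_measurable_continuous_onI continuous_intros assms)

lemma strong_solution_space:
  assumes "CH_strong_solution s T u" "t \<in> {0..T}"
  shows "u t \<in> sobolev s" "continuous_on UNIV (u t)"
  using assms unfolding CH_strong_solution_def sobolev_continuous_on_def by simp_all

text \<open>
  Continuity in the norm of $H^s$ becomes continuity in the uniform norm, for $u$ and $u_x$, through
  the embeddings applied to $u(\tau) - u(t)$.
\<close>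
lemma strong_solution_uniformly_continuous_in_time:
  assumes sol: "CH_strong_solution s T u" and s: "3 / 2 < s" and t: "t \<in> {0..T}" and e: "0 < e"
  shows "\<exists>d>0. \<forall>\<tau>\<in>{0..T}. \<bar>\<tau> - t\<bar> < d \<longrightarrow>
    (\<forall>x. \<bar>u \<tau> x - u t x\<bar> < e \<and> \<bar>deriv (u \<tau>) x - deriv (u t) x\<bar> < e)"
proof -
  note sob = strong_solution_space(1)[OF sol] and cont = strong_solution_space(2)[OF sol]
  have lim: "((\<lambda>\<tau>. sobolev_norm s (\<lambda>x. u \<tau> x - u t x)) \<longlongrightarrow> 0) (at t within {0..T})"
    using sol t unfolding CH_strong_solution_def sobolev_continuous_on_def by simp
  \<comment> \<open>One constant for both embeddings; absolute values make the comparison with either summand immediate.\<close>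
  define K where "K = \<bar>embedding_constant s\<bar> + \<bar>embedding_constant (s - 1)\<bar>"
  have "((\<lambda>\<tau>. K * sobolev_norm s (\<lambda>x. u \<tau> x - u t x)) \<longlongrightarrow> K * 0) (at t within {0..T})"
    by (intro tendsto_mult tendsto_const lim)
  then have "\<forall>\<^sub>F \<tau> in at t within {0..T}. K * sobolev_norm s (\<lambda>x. u \<tau> x - u t x) < e"
    by (rule order_tendstoD) (use e in simp)
  then obtain d where "0 < d" and d: "\<And>\<tau>. \<tau> \<in> {0..T} \<Longrightarrow> \<tau> \<noteq> t \<Longrightarrow> \<bar>\<tau> - t\<bar> < d \<Longrightarrow>
      K * sobolev_norm s (\<lambda>x. u \<tau> x - u t x) < e"
    unfolding eventually_at dist_real_def by blast
  have "\<bar>u \<tau> x - u t x\<bar> < e \<and> \<bar>deriv (u \<tau>) x - deriv (u t) x\<bar> < e"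
    if \<tau>: "\<tau> \<in> {0..T}" "\<bar>\<tau> - t\<bar> < d" for \<tau> x
  proof (cases "\<tau> = t")
    case True
    then show ?thesis using e by simp
  next
    case False
    let ?f = "\<lambda>x. u \<tau> x - u t x"
    have f: "?f \<in> sobolev s" "continuous_on UNIV ?f"
      using sob cont \<tau>(1) t by (auto intro: sobolev_diff continuous_intros)
    have "deriv ?f x = deriv (u \<tau>) x - deriv (u t) x"
      by (intro DERIV_imp_deriv DERIV_diff sobolev_C1(1)[OF s] sob cont \<tau> t)
    moreover have "embedding_constant s * sobolev_norm s ?f \<le> K * sobolev_norm s ?f"
      "embedding_constant (s - 1) * sobolev_norm s ?f \<le> K * sobolev_norm s ?f"
      by (intro mult_right_mono sobolev_norm_nonneg; simp add: K_def)+
    ultimately show ?thesis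
      using d[OF \<tau>(1) False \<tau>(2)] sobolev_C1(3)[OF s f, of x] sobolev_C0[OF _ f, of x] s by linarith
  qed
  then show ?thesis using \<open>0 < d\<close> by blast
qed

text \<open>
  Each time has a neighbourhood with a common bound, and a compact interval is covered by finitely many.
\<close>
lemma strong_solution_bounded:
  assumes sol: "CH_strong_solution s T u" and s: "3 / 2 < s" and T: "0 \<le> T"
  obtains M where "\<And>t x. t \<in> {0..T} \<Longrightarrow> \<bar>u t x\<bar> \<le> M"
    "\<And>t x. t \<in> {0..T} \<Longrightarrow> \<bar>deriv (u t) x\<bar> \<le> M"
proof -
  define P where "P a b \<longleftrightarrow> (\<exists>M. \<forall>t\<in>{a..b} \<inter> {0..T}. \<forall>x. \<bar>u t x\<bar> \<le> M \<and> \<bar>deriv (u t) x\<bar> \<le> M)" for a b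
  have "P 0 T"
  proof (rule Bolzano[OF T])
    fix a b c assume "P a b" "P b c"
    then obtain M1 M2 where
      M1: "\<And>t x. t \<in> {a..b} \<inter> {0..T} \<Longrightarrow> \<bar>u t x\<bar> \<le> M1 \<and> \<bar>deriv (u t) x\<bar> \<le> M1" and
      M2: "\<And>t x. t \<in> {b..c} \<inter> {0..T} \<Longrightarrow> \<bar>u t x\<bar> \<le> M2 \<and> \<bar>deriv (u t) x\<bar> \<le> M2"
      unfolding P_def by blast
    have "\<bar>u t x\<bar> \<le> max M1 M2 \<and> \<bar>deriv (u t) x\<bar> \<le> max M1 M2" if "t \<in> {a..c} \<inter> {0..T}" for t x
      using M1[of t x] M2[of t x] that by (cases "t \<le> b") (auto simp: le_max_iff_disj)
    then show "P a c" unfolding P_def by blast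
  next
    fix t assume t: "0 \<le> t" "t \<le> T"
    then have tI: "t \<in> {0..T}" by simp
    note sob = strong_solution_space(1)[OF sol tI] and cont = strong_solution_space(2)[OF sol tI]
    obtain d where "0 < d" and d: "\<forall>\<tau>\<in>{0..T}. \<bar>\<tau> - t\<bar> < d \<longrightarrow>
        (\<forall>x. \<bar>u \<tau> x - u t x\<bar> < 1 \<and> \<bar>deriv (u \<tau>) x - deriv (u t) x\<bar> < 1)"
      using strong_solution_uniformly_continuous_in_time[OF sol s tI, of 1] by auto
    define M where "M = max (embedding_constant s * sobolev_norm s (u t)) (embedding_constant (s - 1) * sobolev_norm s (u t)) + 1"
    have "\<bar>u \<tau> x\<bar> \<le> M \<and> \<bar>deriv (u \<tau>) x\<bar> \<le> M" if "\<tau> \<in> {0..T}" "\<bar>\<tau> - t\<bar> < d" for \<tau> x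
      using d[rule_format, OF that, of x] sobolev_C0[OF _ sob cont, of x] sobolev_C1(3)[OF s sob cont, of x] s
      unfolding M_def by linarith
    then have M: "\<bar>u \<tau> x\<bar> \<le> M \<and> \<bar>deriv (u \<tau>) x\<bar> \<le> M" if "\<tau> \<in> {0..T}" "\<bar>\<tau> - t\<bar> < d" for \<tau> x
      using that by blast
    have "P a b" if ab: "a \<le> t" "t \<le> b" "b - a < d" for a b
      unfolding P_def
    proof (intro exI ballI allI)
      fix \<tau> x assume \<tau>: "\<tau> \<in> {a..b} \<inter> {0..T}"
      then have "\<bar>\<tau> - t\<bar> < d" using ab by (simp add: abs_less_iff)
      with \<tau> show "\<bar>u \<tau> x\<bar> \<le> M \<and> \<bar>deriv (u \<tau>) x\<bar> \<le> M" by (intro M) simp_all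
    qed
    then show "\<exists>d>0. \<forall>a b. a \<le> t \<and> t \<le> b \<and> b - a < d \<longrightarrow> P a b"
      using \<open>0 < d\<close> by blast
  qed
  then obtain M where "\<forall>t\<in>{0..T} \<inter> {0..T}. \<forall>x. \<bar>u t x\<bar> \<le> M \<and> \<bar>deriv (u t) x\<bar> \<le> M"
    unfolding P_def by blast
  then show thesis by (intro that[of M]) simp_all
qed

lemma strong_solution_jointly_continuous:
  assumes sol: "CH_strong_solution s T u" and s: "3 / 2 < s"
  shows "continuous_on ({0..T} \<times> UNIV) (\<lambda>(t, x). u t x)"
  unfolding continuous_on_iff
proof (intro ballI allI impI)
  fix p :: "real \<times> real" and e :: real
  assume p: "p \<in> {0..T} \<times> UNIV" and e: "0 < e"
  obtain t x where px: "p = (t, x)" and t: "t \<in> {0..T}" using p by auto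
  have "continuous_on UNIV (u t)" using sol t by (simp add: CH_strong_solution_def)
  then obtain d1 where "0 < d1" and d1: "\<And>y. \<bar>y - x\<bar> < d1 \<Longrightarrow> \<bar>u t y - u t x\<bar> < e / 2"
    using e unfolding continuous_on_iff dist_real_def by (meson UNIV_I half_gt_zero)
  obtain d2 where "0 < d2" and "\<forall>\<tau>\<in>{0..T}. \<bar>\<tau> - t\<bar> < d2 \<longrightarrow>
      (\<forall>x. \<bar>u \<tau> x - u t x\<bar> < e / 2 \<and> \<bar>deriv (u \<tau>) x - deriv (u t) x\<bar> < e / 2)"
    using strong_solution_uniformly_continuous_in_time[OF sol s t, of "e / 2"] e by auto
  then have d2: "\<bar>u \<tau> y - u t y\<bar> < e / 2" if "\<tau> \<in> {0..T}" "\<bar>\<tau> - t\<bar> < d2" for \<tau> y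
    using that by blast
  have "dist (case q of (\<tau>, y) \<Rightarrow> u \<tau> y) (case p of (\<tau>, y) \<Rightarrow> u \<tau> y) < e"
    if q: "q \<in> {0..T} \<times> UNIV" "dist q p < min d1 d2" for q
  proof -
    obtain \<tau> y where qy: "q = (\<tau>, y)" and \<tau>: "\<tau> \<in> {0..T}" using q by auto
    have "\<bar>\<tau> - t\<bar> < d2" "\<bar>y - x\<bar> < d1"
      using q(2) dist_fst_le[of q p] dist_snd_le[of q p] by (simp_all add: qy px dist_real_def)
    then have "\<bar>u t y - u t x\<bar> < e / 2" "\<bar>u \<tau> y - u t y\<bar> < e / 2"
      using d1[of y] d2[OF \<tau>, of y] by simp_all
    then have "\<bar>u \<tau> y - u t x\<bar> < e" by linarith
    then show ?thesis by (simp add: qy px dist_real_def)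
  qed
  then show "\<exists>d>0. \<forall>q\<in>{0..T} \<times> UNIV. dist q p < d \<longrightarrow>
      dist (case q of (\<tau>, y) \<Rightarrow> u \<tau> y) (case p of (\<tau>, y) \<Rightarrow> u \<tau> y) < e"
    using \<open>0 < d1\<close> \<open>0 < d2\<close> by (intro exI[of _ "min d1 d2"] conjI ballI impI) simp_all
qed

text \<open>
  The right side is continuous in $x$, so the quotient $(u(\tau) - u(t))/(\tau - t)$ minus it is the
  continuous representative of a class whose norm in $H^{s-1}$ tends to $0$.  As $s - 1 > 1/2$, it tends to $0$
  at every point.
\<close>
lemma strong_solution_time_derivative:
  assumes sol: "CH_strong_solution s T u" and s: "3 / 2 < s" and t: "t \<in> {0..T}"
  shows "((\<lambda>\<tau>. u \<tau> x) has_real_derivative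
      - (u t x * deriv (u t) x) - Defs.convolution (deriv G) (CH_source (u t)) x) (at t within {0..T})"
proof -
  note sob = strong_solution_space(1)[OF sol] and cont = strong_solution_space(2)[OF sol]
  from sol obtain v where v: "has_sobolev_derivative_on (s - 1) {0..T} u v"
    and eqn: "\<And>t. t \<in> {0..T} \<Longrightarrow> AE x in lborel. v t x + u t x * deriv (u t) x
               + Defs.convolution (deriv G) (\<lambda>y. (u t y)\<^sup>2 + 1/2 * (deriv (u t) y)\<^sup>2) x = 0"
    unfolding CH_strong_solution_def by blast
  from v have low: "\<And>\<tau>. \<tau> \<in> {0..T} \<Longrightarrow> u \<tau> \<in> sobolev (s - 1)" and vt: "v t \<in> sobolev (s - 1)"
    and lim: "((\<lambda>\<tau>. sobolev_norm (s - 1) (\<lambda>x. (u \<tau> x - u t x) / (\<tau> - t) - v t x)) \<longlongrightarrow> 0) (at t within {0..T})"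
    using t by (auto simp: has_sobolev_derivative_on_def)
  define W where "W x = - (u t x * deriv (u t) x) - Defs.convolution (deriv G) (CH_source (u t)) x" for x
  have dcont: "continuous_on UNIV (deriv (u t))"
    by (rule sobolev_C1(2)[OF s sob[OF t] cont[OF t]])
  have Wcont: "continuous_on UNIV W"
  proof -
    define M where "M = max (embedding_constant s * sobolev_norm s (u t)) (embedding_constant (s - 1) * sobolev_norm s (u t))"
    have "\<bar>u t y\<bar> \<le> M" "\<bar>deriv (u t) y\<bar> \<le> M" for y
      using sobolev_C0[OF _ sob[OF t] cont[OF t], of y] sobolev_C1(3)[OF s sob[OF t] cont[OF t], of y] s
      unfolding M_def by linarith+
    then have "\<bar>CH_source (u t) y\<bar> \<le> 2 * (M * M)" for y by (intro CH_source_bound)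
    then have "continuous_on UNIV (Defs.convolution (deriv G) (CH_source (u t)))"
      by (intro convolution_deriv_G_continuous CH_source_measurable cont[OF t] dcont)
    then show ?thesis
      unfolding W_def by (intro continuous_intros cont[OF t] dcont)
  qed
  have vW: "AE x in lborel. v t x = W x"
    using eqn[OF t] unfolding W_def CH_source_def[abs_def] by eventually_elim linarith
  define K where "K = embedding_constant (s - 1)"
  have bound: "norm ((u \<tau> x - u t x) / (\<tau> - t) - W x) \<le> K * sobolev_norm (s - 1) (\<lambda>x. (u \<tau> x - u t x) / (\<tau> - t) - v t x)"
    if \<tau>: "\<tau> \<in> {0..T}" for \<tau>
  proof -
    \<comment> \<open>\<open>q\<close> is the quotient in the definition of the derivative, \<open>q'\<close> its continuous representative.\<close>
    let ?q = "\<lambda>x. (u \<tau> x - u t x) / (\<tau> - t) - v t x" and ?q' = "\<lambda>x. (u \<tau> x - u t x) / (\<tau> - t) - W x"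
    have "(\<lambda>x. inverse (\<tau> - t) * (u \<tau> x - u t x)) \<in> sobolev (s - 1)"
      by (intro sobolev_scale sobolev_diff low \<tau> t)
    then have q: "?q \<in> sobolev (s - 1)"
      by (intro sobolev_diff vt) (simp add: divide_inverse mult.commute)
    have q'cont: "continuous_on UNIV ?q'"
      unfolding divide_inverse by (intro continuous_intros cont \<tau> t Wcont)
    have "AE x in lborel. ?q x = ?q' x" using vW by eventually_elim simp
    note tr = sobolev_cong_AE[OF q this borel_measurable_continuous_onI[OF q'cont]]
    show ?thesis
      using sobolev_C0[OF _ tr(1) q'cont, of x] s by (simp add: tr(2) K_def)
  qed
  have "((\<lambda>\<tau>. K * sobolev_norm (s - 1) (\<lambda>x. (u \<tau> x - u t x) / (\<tau> - t) - v t x)) \<longlongrightarrow> K * 0) (at t within {0..T})"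
    by (intro tendsto_mult tendsto_const lim)
  then have lim0: "((\<lambda>\<tau>. K * sobolev_norm (s - 1) (\<lambda>x. (u \<tau> x - u t x) / (\<tau> - t) - v t x)) \<longlongrightarrow> 0) (at t within {0..T})"
    by simp
  have "\<forall>\<^sub>F \<tau> in at t within {0..T}. norm ((u \<tau> x - u t x) / (\<tau> - t) - W x)
      \<le> K * sobolev_norm (s - 1) (\<lambda>x. (u \<tau> x - u t x) / (\<tau> - t) - v t x)"
    unfolding eventually_at_filter by (intro always_eventually allI impI bound)
  then have "((\<lambda>\<tau>. (u \<tau> x - u t x) / (\<tau> - t) - W x) \<longlongrightarrow> 0) (at t within {0..T})"
    by (rule Lim_null_comparison[OF _ lim0])
  then show ?thesis
    unfolding has_field_derivative_iff W_def[symmetric] by (subst Lim_null)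
qed

section \<open>Propagation of exponential decay\<close>

text \<open>
  To the left of the threshold the exponential is bounded below, so a bounded function is dominated there too.
\<close>
lemma bigo_exp_imp_global_bound:
  fixes f :: "real \<Rightarrow> real"
  assumes "f \<in> O[at_top](\<lambda>x. exp (- a * x))" "0 \<le> a" and bounded: "\<And>x. \<bar>f x\<bar> \<le> M"
  obtains C where "0 \<le> C" "\<And>x. \<bar>f x\<bar> \<le> C * exp (- a * x)"
proof -
  obtain c where c: "0 < c" "\<forall>\<^sub>F x in at_top. norm (f x) \<le> c * norm (exp (- a * x))"
    using landau_o.bigE[OF assms(1)] by blast
  then obtain X where X: "\<And>x. X \<le> x \<Longrightarrow> \<bar>f x\<bar> \<le> c * exp (- a * x)"
    unfolding eventually_at_top_linorder by auto
  have M: "0 \<le> M" using bounded[of 0] by linarith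
  have "\<bar>f x\<bar> \<le> (c + M * exp (a * X)) * exp (- a * x)" for x
  proof (cases "X \<le> x")
    case True
    have "0 \<le> M * exp (a * X) * exp (- a * x)" using M by simp
    then show ?thesis using X[OF True] by (simp add: distrib_right)
  next
    case False
    then have "a * x \<le> a * X" using assms(2) by (intro mult_left_mono) auto
    then have "1 \<le> exp (a * X) * exp (- a * x)" by (simp add: exp_add[symmetric])
    then have "M * 1 \<le> M * (exp (a * X) * exp (- a * x))" using M by (intro mult_left_mono)
    moreover have "0 \<le> c * exp (- a * x)" using c(1) by simp
    ultimately show ?thesis using bounded[of x] by (simp add: distrib_right mult.assoc)
  qed
  then show thesis using that[of "c + M * exp (a * X)"] c(1) M by simp
qed

lemma le_of_le_perturbation:
  fixes a b c :: real
  assumes "\<And>\<delta>. 0 < \<delta> \<Longrightarrow> a \<le> b + \<delta> * c"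
  shows "a \<le> b"
proof -
  have "((\<lambda>\<delta>. b + \<delta> * c) \<longlongrightarrow> b + 0 * c) (at_right 0)"
    by (intro tendsto_add tendsto_const tendsto_mult tendsto_ident_at)
  then have "a \<le> b + 0 * c"
    by (rule tendsto_lowerbound) (use assms in \<open>auto simp: eventually_at_filter\<close>)
  then show ?thesis by simp
qed

text \<open>
  A strong solution after passage to pointwise statements.  The constant $M$ is an a priori bound, and all that
  the decay argument uses is collected here.
\<close>
locale CH_classical_solution =
  fixes T M :: real and u :: "real \<Rightarrow> real \<Rightarrow> real"
  assumes T: "0 \<le> T"
    and M: "0 < M"
    and u_bound: "\<And>t x. t \<in> {0..T} \<Longrightarrow> \<bar>u t x\<bar> \<le> M"
    and ux_bound: "\<And>t x. t \<in> {0..T} \<Longrightarrow> \<bar>deriv (u t) x\<bar> \<le> M"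
    and u_x: "\<And>t x. t \<in> {0..T} \<Longrightarrow> (u t has_real_derivative deriv (u t) x) (at x)"
    and ux_continuous: "\<And>t. t \<in> {0..T} \<Longrightarrow> continuous_on UNIV (deriv (u t))"
    and u_continuous: "continuous_on ({0..T} \<times> UNIV) (\<lambda>(t, x). u t x)"
    and u_t: "\<And>t x. t \<in> {0..T} \<Longrightarrow> ((\<lambda>\<tau>. u \<tau> x) has_real_derivative
        - (u t x * deriv (u t) x) - Defs.convolution (deriv G) (CH_source (u t)) x) (at t within {0..T})"
begin

abbreviation nonlocal :: "real \<Rightarrow> real \<Rightarrow> real" where
  "nonlocal t x \<equiv> Defs.convolution (deriv G) (CH_source (u t)) x"

lemma source_measurable: "t \<in> {0..T} \<Longrightarrow> CH_source (u t) \<in> borel_measurable borel"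
  by (intro CH_source_measurable ux_continuous continuous_at_imp_continuous_on ballI DERIV_isCont[OF u_x])

lemma increment_jointly_continuous:
  "continuous_on ({0..T} \<times> UNIV) (\<lambda>(t, x). (u t (x + h) - u t x) / h)"
proof -
  have "continuous_on ({0..T} \<times> UNIV) (\<lambda>p. u (fst p) (snd p))"
    using u_continuous by (simp add: case_prod_beta)
  moreover from this have "continuous_on ({0..T} \<times> UNIV) (\<lambda>p. u (fst (fst p, snd p + h)) (snd (fst p, snd p + h)))"
    by (rule continuous_on_compose2) (auto intro!: continuous_intros)
  ultimately show ?thesis
    unfolding case_prod_beta divide_inverse by (intro continuous_intros) simp_all
qed

text \<open>
  The gain comes from $K$.  The source is bounded by $\kappa B e^{Kt} \omega$, and the
  maximum principle divides this by $K - M - c$, which is at least $2 \kappa$ for $u$ (with $c = 0$) and for its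
  difference quotients (with $c = M$).
\<close>
lemma weighted_bound_improves:
  assumes \<alpha>: "0 < \<alpha>" "\<alpha> < 1" and \<delta>: "0 < \<delta>"
    and init: "\<And>x. \<bar>u 0 x\<bar> \<le> C * exp (- \<alpha> * x)" "\<And>x. \<bar>deriv (u 0) x\<bar> \<le> C * exp (- \<alpha> * x)"
    and K: "K = 2 * M + 2 * \<kappa>" and \<kappa>: "\<kappa> = exp 1 * (1 / (1 - \<alpha>) + 1) * (2 * M)"
    and old: "\<And>t x. t \<in> {0..T} \<Longrightarrow> \<bar>u t x\<bar> \<le> B * (exp (K * t) * two_sided_weight \<alpha> \<delta> x)"
      "\<And>t x. t \<in> {0..T} \<Longrightarrow> \<bar>deriv (u t) x\<bar> \<le> B * (exp (K * t) * two_sided_weight \<alpha> \<delta> x)"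
    and t: "t \<in> {0..T}"
  shows "\<bar>u t x\<bar> \<le> max C (B / 2) * (exp (K * t) * two_sided_weight \<alpha> \<delta> x)"
    and "\<bar>deriv (u t) x\<bar> \<le> max C (B / 2) * (exp (K * t) * two_sided_weight \<alpha> \<delta> x)"
proof -
  let ?\<omega> = "two_sided_weight \<alpha> \<delta>"
  have \<omega>pos: "0 < ?\<omega> x" for x using \<delta> by (intro two_sided_weight_pos) simp
  have \<kappa>pos: "0 < \<kappa>" using M \<alpha> unfolding \<kappa> by (intro mult_pos_pos add_pos_pos) auto
  have K0: "0 \<le> K" using M \<kappa>pos by (simp add: K)
  have T0: "0 \<in> {0..T}" using T by simp
  have C: "0 \<le> C"
  proof -
    have "0 \<le> \<bar>u 0 0\<bar>" by simp
    also have "\<dots> \<le> C" using init(1)[of 0] by simp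
    finally show ?thesis .
  qed
  have B: "0 \<le> B"
  proof (rule ccontr)
    assume "\<not> ?thesis"
    then have "B * ?\<omega> 0 < 0" using \<omega>pos[of 0] by (simp add: mult_neg_pos)
    then show False using old(1)[OF T0, of 0] by simp
  qed
  have C\<omega>: "C * exp (- \<alpha> * x) \<le> max C (B / 2) * ?\<omega> x" for x
    using C \<delta> by (intro mult_mono exp_le_two_sided_weight) auto
  have source: "\<bar>CH_source (u t) y\<bar> \<le> (2 * (M * (B * (exp (K * t) * ?\<omega> x)))) * exp (\<alpha> * \<bar>x - y\<bar>)"
    if t: "t \<in> {0..T}" for t x y
  proof -
    have "\<bar>CH_source (u t) y\<bar> \<le> 2 * (M * (B * (exp (K * t) * ?\<omega> y)))"
      by (intro CH_source_bound u_bound ux_bound old t)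
    also have "\<dots> \<le> 2 * (M * (B * (exp (K * t) * (exp (\<alpha> * \<bar>x - y\<bar>) * ?\<omega> x))))"
      using M B \<alpha> \<delta> by (intro mult_left_mono two_sided_weight_translate) auto
    finally show ?thesis by (simp only: mult_ac)
  qed
  have nonloc: "\<bar>nonlocal t x\<bar> \<le> \<kappa> * B * (exp (K * t) * ?\<omega> x)" if t: "t \<in> {0..T}" for t x
  proof -
    let ?A = "2 * (M * (B * (exp (K * t) * ?\<omega> x)))"
    have A: "0 \<le> ?A" using M B \<omega>pos[of x] by simp
    have k: "0 < 1 - \<alpha>" using \<alpha> by simp
    have "exp (- \<bar>x - y\<bar>) * \<bar>CH_source (u t) y\<bar> \<le> ?A * exp (- (1 - \<alpha>) * \<bar>y - x\<bar>)" for y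
    proof -
      have "exp (- \<bar>x - y\<bar>) * \<bar>CH_source (u t) y\<bar> \<le> exp (- \<bar>x - y\<bar>) * (?A * exp (\<alpha> * \<bar>x - y\<bar>))"
        by (intro mult_left_mono source t) simp
      also have "\<dots> = ?A * (exp (- \<bar>x - y\<bar>) * exp (\<alpha> * \<bar>x - y\<bar>))" by (simp only: mult_ac)
      also have "exp (- \<bar>x - y\<bar>) * exp (\<alpha> * \<bar>x - y\<bar>) = exp (- (1 - \<alpha>) * \<bar>y - x\<bar>)"
        unfolding exp_add[symmetric] abs_minus_commute[of x y] by (simp add: algebra_simps)
      finally show ?thesis .
    qed
    from convolution_deriv_G_bound(2)[OF k source_measurable[OF t] this]
    have "\<bar>nonlocal t x\<bar> \<le> ?A * (1 / (1 - \<alpha>))" by simp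
    also have "\<dots> \<le> ?A * (exp 1 * (1 / (1 - \<alpha>) + 1))"
    proof (intro mult_left_mono A)
      have "1 * (1 / (1 - \<alpha>)) \<le> exp 1 * (1 / (1 - \<alpha>) + 1)"
        using k by (intro mult_mono) auto
      then show "1 / (1 - \<alpha>) \<le> exp 1 * (1 / (1 - \<alpha>) + 1)" by simp
    qed
    finally show ?thesis unfolding \<kappa> by (simp only: mult_ac)
  qed
  have half: "\<kappa> * B \<le> 2 * \<kappa> * max C (B / 2)"
  proof -
    have "2 * \<kappa> * (B / 2) \<le> 2 * \<kappa> * max C (B / 2)" using \<kappa>pos by (intro mult_left_mono) auto
    then show ?thesis by simp
  qed
  show "\<bar>u t x\<bar> \<le> max C (B / 2) * (exp (K * t) * ?\<omega> x)"
  proof (rule transport_maximum_principle[where w = u and a = u and M = M and c = 0 and r = "\<kappa> * B",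
        OF \<alpha>(1) less_imp_le[OF \<alpha>(2)] \<delta> K0 u_continuous u_bound u_t u_x u_bound])
    fix t x assume t: "t \<in> {0..T}"
    show "\<bar>- (u t x * deriv (u t) x) - nonlocal t x + u t x * deriv (u t) x\<bar>
        \<le> 0 * \<bar>u t x\<bar> + \<kappa> * B * (exp (K * t) * ?\<omega> x)"
      using nonloc[OF t, of x] by simp
  next
    fix x
    show "\<bar>u 0 x\<bar> \<le> max C (B / 2) * ?\<omega> x"
      using init(1)[of x] C\<omega>[of x] by linarith
  next
    have "0 \<le> M * max C (B / 2)" using M C by simp
    then show "\<kappa> * B \<le> (K - M - 0) * max C (B / 2)"
      using half unfolding K by (simp add: algebra_simps)
  qed (use M \<kappa>pos t in \<open>simp_all add: K\<close>)
  have increment: "\<bar>(u t (x + h) - u t x) / h\<bar> \<le> max C (B / 2) * (exp (K * t) * ?\<omega> x)"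
    if h: "0 < h" "h \<le> 1" for h
  proof (rule transport_maximum_principle[where w = "\<lambda>t x. (u t (x + h) - u t x) / h"
        and a = "\<lambda>t x. u t (x + h)" and N = "2 * M / h"
        and wx = "\<lambda>t x. (deriv (u t) (x + h) - deriv (u t) x) / h"
        and wt = "\<lambda>t x. ((- (u t (x + h) * deriv (u t) (x + h)) - nonlocal t (x + h))
                    - (- (u t x * deriv (u t) x) - nonlocal t x)) / h"
        and M = M and c = M and r = "\<kappa> * B",
        OF \<alpha>(1) less_imp_le[OF \<alpha>(2)] \<delta> K0 increment_jointly_continuous])
    fix t x assume t: "t \<in> {0..T}"
    show "\<bar>(u t (x + h) - u t x) / h\<bar> \<le> 2 * M / h"
      using u_bound[OF t, of "x + h"] u_bound[OF t, of x] h
      by (simp add: abs_divide divide_right_mono)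
    show "((\<lambda>\<tau>. (u \<tau> (x + h) - u \<tau> x) / h) has_real_derivative
        ((- (u t (x + h) * deriv (u t) (x + h)) - nonlocal t (x + h))
          - (- (u t x * deriv (u t) x) - nonlocal t x)) / h) (at t within {0..T})"
      by (intro DERIV_cdivide DERIV_diff u_t t)
    have "((\<lambda>x. u t (x + h)) has_real_derivative deriv (u t) (x + h)) (at x)"
      using u_x[OF t, of "x + h"] by (simp add: DERIV_shift)
    then show "((\<lambda>x. (u t (x + h) - u t x) / h) has_real_derivative
        (deriv (u t) (x + h) - deriv (u t) x) / h) (at x)"
      by (intro DERIV_cdivide DERIV_diff u_x t)
    show "\<bar>u t (x + h)\<bar> \<le> M" by (rule u_bound[OF t])
    \<comment> \<open>The discrete product rule $u(x+h) u_x(x+h) - u(x) u_x(x) = u(x+h) (u_x(x+h) - u_x(x)) + (u(x+h) - u(x)) u_x(x)$ makes the quotient a solution of a transport equation with speed $u(x+h)$ and a zero order term with coefficient $u_x$.\<close>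
    have rewrite: "((- (u t (x + h) * deriv (u t) (x + h)) - nonlocal t (x + h))
          - (- (u t x * deriv (u t) x) - nonlocal t x)) / h
        + u t (x + h) * ((deriv (u t) (x + h) - deriv (u t) x) / h)
        = - (deriv (u t) x * ((u t (x + h) - u t x) / h)) - (nonlocal t (x + h) - nonlocal t x) / h"
      using h by (simp add: field_simps)
    have "\<bar>deriv (u t) x * ((u t (x + h) - u t x) / h)\<bar> \<le> M * \<bar>(u t (x + h) - u t x) / h\<bar>"
      unfolding abs_mult by (intro mult_right_mono ux_bound t) simp
    moreover have "\<bar>(nonlocal t (x + h) - nonlocal t x) / h\<bar> \<le> \<kappa> * B * (exp (K * t) * ?\<omega> x)"
    proof -
      have "\<bar>nonlocal t (x + h) - nonlocal t x\<bar>
          \<le> h * (exp 1 * (1 / (1 - \<alpha>) + 1) * (2 * (M * (B * (exp (K * t) * ?\<omega> x)))))"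
        using h by (intro convolution_deriv_G_increment source_measurable source t less_imp_le[OF \<alpha>(1)] \<alpha>(2)) auto
      also have "\<dots> = h * (\<kappa> * B * (exp (K * t) * ?\<omega> x))"
        unfolding \<kappa> by (simp only: mult_ac)
      finally show ?thesis using h by (simp add: abs_divide pos_divide_le_eq mult.commute)
    qed
    ultimately show "\<bar>((- (u t (x + h) * deriv (u t) (x + h)) - nonlocal t (x + h))
          - (- (u t x * deriv (u t) x) - nonlocal t x)) / h
        + u t (x + h) * ((deriv (u t) (x + h) - deriv (u t) x) / h)\<bar>
        \<le> M * \<bar>(u t (x + h) - u t x) / h\<bar> + \<kappa> * B * (exp (K * t) * ?\<omega> x)"
      unfolding rewrite by linarith
  next
    fix x
    \<comment> \<open>Here $h > 0$ matters: $z$ lies to the right of $x$, where the bound on the initial slope is smaller.\<close>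
    obtain z where z: "x < z" "z < x + h" "u 0 (x + h) - u 0 x = (x + h - x) * deriv (u 0) z"
      using MVT2[of x "x + h" "u 0" "deriv (u 0)"] u_x[OF T0] h by auto
    have "\<bar>(u 0 (x + h) - u 0 x) / h\<bar> = \<bar>deriv (u 0) z\<bar>" using z(3) h by simp
    also have "\<dots> \<le> C * exp (- \<alpha> * z)" by (rule init(2))
    also have "\<dots> \<le> C * exp (- \<alpha> * x)" using C \<alpha> z(1) by (intro mult_left_mono) auto
    also have "\<dots> \<le> max C (B / 2) * ?\<omega> x" by (rule C\<omega>)
    finally show "\<bar>(u 0 (x + h) - u 0 x) / h\<bar> \<le> max C (B / 2) * ?\<omega> x" .
  next
    show "\<kappa> * B \<le> (K - M - M) * max C (B / 2)" using half unfolding K by simp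
  qed (use M \<kappa>pos t in \<open>simp_all add: K\<close>)
  have "((\<lambda>h. (u t (x + h) - u t x) / h) \<longlongrightarrow> deriv (u t) x) (at_right 0)"
    using DERIV_D[OF u_x[OF t, of x]] by (rule tendsto_mono[rotated]) (simp add: at_within_le_at)
  then have "((\<lambda>h. \<bar>(u t (x + h) - u t x) / h\<bar>) \<longlongrightarrow> \<bar>deriv (u t) x\<bar>) (at_right 0)"
    by (rule tendsto_rabs)
  moreover have "\<forall>\<^sub>F h in at_right (0::real). \<bar>(u t (x + h) - u t x) / h\<bar> \<le> max C (B / 2) * (exp (K * t) * ?\<omega> x)"
    unfolding eventually_at_right_field
    by (intro exI[of _ 1] conjI allI impI increment) auto
  ultimately show "\<bar>deriv (u t) x\<bar> \<le> max C (B / 2) * (exp (K * t) * ?\<omega> x)"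
    by (rule tendsto_upperbound) simp
qed

text \<open>
  Iterating the improvement starts from $B = M / \min(1, \delta)$, which only uses boundedness, and ends at
  the initial constant $C$.  The final constant does not depend on $\delta$, so $\delta$ may tend to $0$.
\<close>
lemma decay_below_one:
  assumes \<alpha>: "0 < \<alpha>" "\<alpha> < 1"
    and init: "\<And>x. \<bar>u 0 x\<bar> \<le> C * exp (- \<alpha> * x)" "\<And>x. \<bar>deriv (u 0) x\<bar> \<le> C * exp (- \<alpha> * x)"
  obtains L where "\<And>t x. t \<in> {0..T} \<Longrightarrow> \<bar>u t x\<bar> \<le> L * exp (- \<alpha> * x)"
    "\<And>t x. t \<in> {0..T} \<Longrightarrow> \<bar>deriv (u t) x\<bar> \<le> L * exp (- \<alpha> * x)"
proof -
  define \<kappa> where "\<kappa> = exp 1 * (1 / (1 - \<alpha>) + 1) * (2 * M)"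
  define K where "K = 2 * M + 2 * \<kappa>"
  have "0 < \<kappa>" using M \<alpha> unfolding \<kappa>_def by (intro mult_pos_pos add_pos_pos) auto
  then have K0: "0 \<le> K" using M by (simp add: K_def)
  have C: "0 \<le> C" using order_trans[OF abs_ge_zero init(1)[of 0]] by simp
  have limit: "\<bar>u t x\<bar> \<le> C * (exp (K * t) * two_sided_weight \<alpha> \<delta> x)
      \<and> \<bar>deriv (u t) x\<bar> \<le> C * (exp (K * t) * two_sided_weight \<alpha> \<delta> x)"
    if t: "t \<in> {0..T}" and \<delta>: "0 < \<delta>" for t x \<delta>
  proof -
    let ?\<omega> = "two_sided_weight \<alpha> \<delta>"
    define B where "B = M / min 1 \<delta>"
    have B: "0 \<le> B" using M \<delta> by (simp add: B_def)
    have low: "min 1 \<delta> \<le> ?\<omega> x" for x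
    proof (cases "0 \<le> x")
      case True
      then have "\<delta> * 1 \<le> \<delta> * exp (\<alpha> * x)" using \<alpha> \<delta> by (intro mult_left_mono) auto
      moreover have "0 < exp (- \<alpha> * x)" by simp
      ultimately show ?thesis unfolding two_sided_weight_def by linarith
    next
      case False
      then have "1 \<le> exp (- \<alpha> * x)" using \<alpha> by (simp add: mult_nonneg_nonpos)
      moreover have "0 < \<delta> * exp (\<alpha> * x)" using \<delta> by simp
      ultimately show ?thesis unfolding two_sided_weight_def by linarith
    qed
    have start: "M \<le> B * (exp (K * t) * ?\<omega> x)" if "t \<in> {0..T}" for t x
    proof -
      have "M = B * (1 * min 1 \<delta>)" using \<delta> by (simp add: B_def)
      also have "\<dots> \<le> B * (exp (K * t) * ?\<omega> x)"
        using B K0 that \<delta> low[of x] by (intro mult_left_mono mult_mono) auto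
      finally show ?thesis .
    qed
    have step: "\<forall>t\<in>{0..T}. \<forall>x. \<bar>u t x\<bar> \<le> max C (B / 2 ^ n) * (exp (K * t) * ?\<omega> x)
        \<and> \<bar>deriv (u t) x\<bar> \<le> max C (B / 2 ^ n) * (exp (K * t) * ?\<omega> x)" for n
    proof (induction n)
      case 0
      have "\<bar>u t x\<bar> \<le> max C B * (exp (K * t) * ?\<omega> x) \<and> \<bar>deriv (u t) x\<bar> \<le> max C B * (exp (K * t) * ?\<omega> x)"
        if t: "t \<in> {0..T}" for t x
      proof -
        have "B * (exp (K * t) * ?\<omega> x) \<le> max C B * (exp (K * t) * ?\<omega> x)"
          using two_sided_weight_pos[of \<delta> \<alpha> x] \<delta> by (intro mult_right_mono) auto
        then show ?thesis using u_bound[OF t, of x] ux_bound[OF t, of x] start[OF t, of x] by linarith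
      qed
      then show ?case by simp
    next
      case (Suc n)
      \<comment> \<open>Halving an iterate that has already reached $C$ stays below $C$, because $C \ge 0$.\<close>
      have eq: "max C (max C (B / 2 ^ n) / 2) = max C (B / 2 ^ Suc n)"
        using C by (auto simp: max_def)
      show ?case
      proof (intro ballI allI conjI)
        fix t x assume t: "t \<in> {0..T}"
        show "\<bar>u t x\<bar> \<le> max C (B / 2 ^ Suc n) * (exp (K * t) * ?\<omega> x)"
          unfolding eq[symmetric]
          by (rule weighted_bound_improves(1)[OF \<alpha> \<delta> init K_def \<kappa>_def _ _ t]) (use Suc in blast)+
        show "\<bar>deriv (u t) x\<bar> \<le> max C (B / 2 ^ Suc n) * (exp (K * t) * ?\<omega> x)"
          unfolding eq[symmetric]
          by (rule weighted_bound_improves(2)[OF \<alpha> \<delta> init K_def \<kappa>_def _ _ t]) (use Suc in blast)+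
      qed
    qed
    have "(\<lambda>n. B * (1 / 2) ^ n) \<longlonglongrightarrow> B * 0"
      by (rule tendsto_mult[OF tendsto_const]) (rule LIMSEQ_power_zero; simp)
    then have "(\<lambda>n. B / 2 ^ n) \<longlonglongrightarrow> 0" by (simp add: power_one_over)
    then have "(\<lambda>n. max C (B / 2 ^ n)) \<longlonglongrightarrow> max C 0" by (rule tendsto_max[OF tendsto_const])
    then have lim: "(\<lambda>n. max C (B / 2 ^ n) * (exp (K * t) * ?\<omega> x)) \<longlonglongrightarrow> C * (exp (K * t) * ?\<omega> x)"
      using C by (intro tendsto_mult_right) simp
    show ?thesis
      using step t by (intro conjI LIMSEQ_le_const[OF lim]) blast+
  qed
  have mono: "C * exp (K * t) * exp (- \<alpha> * x) \<le> C * exp (K * T) * exp (- \<alpha> * x)" if "t \<in> {0..T}" for t x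
    using C K0 that by (intro mult_right_mono mult_left_mono) (auto intro!: mult_left_mono)
  have expand: "C * (exp (K * t) * two_sided_weight \<alpha> \<delta> x)
      = C * exp (K * t) * exp (- \<alpha> * x) + \<delta> * (C * exp (K * t) * exp (\<alpha> * x))" for t x \<delta>
    unfolding two_sided_weight_def by (simp only: distrib_left mult_ac)
  show thesis
  proof (rule that)
    fix t x assume t: "t \<in> {0..T}"
    have "\<bar>u t x\<bar> \<le> C * exp (K * t) * exp (- \<alpha> * x)"
      by (rule le_of_le_perturbation) (rule limit[OF t, THEN conjunct1, unfolded expand])
    then show "\<bar>u t x\<bar> \<le> (C * exp (K * T)) * exp (- \<alpha> * x)" using mono[OF t, of x] by linarith
    have "\<bar>deriv (u t) x\<bar> \<le> C * exp (K * t) * exp (- \<alpha> * x)"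
      by (rule le_of_le_perturbation) (rule limit[OF t, THEN conjunct2, unfolded expand])
    then show "\<bar>deriv (u t) x\<bar> \<le> (C * exp (K * T)) * exp (- \<alpha> * x)" using mono[OF t, of x] by linarith
  qed
qed

text \<open>
  From $e^{-|x-y|} \le e^{-x} e^{y}$ the factor $e^{-x}$ splits off, and
  $e^{y}$ is integrable against the source: for $y \ge 0$ because the source decays like
  $e^{-2 \alpha y}$ with $2 \alpha > 1$, for $y < 0$ because the source is bounded.
\<close>
lemma nonlocal_decay:
  assumes \<alpha>: "1 / 2 < \<alpha>" "\<alpha> < 1"
    and decay: "\<And>t x. t \<in> {0..T} \<Longrightarrow> \<bar>u t x\<bar> \<le> L * exp (- \<alpha> * x)"
      "\<And>t x. t \<in> {0..T} \<Longrightarrow> \<bar>deriv (u t) x\<bar> \<le> L * exp (- \<alpha> * x)"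
    and t: "t \<in> {0..T}"
  shows "\<bar>nonlocal t x\<bar> \<le> 2 * (M * M + L * L) / (2 * \<alpha> - 1) * exp (- x)"
proof -
  let ?k = "2 * \<alpha> - 1" and ?A = "2 * (M * M + L * L)"
  have k: "0 < ?k" using \<alpha> by simp
  have "exp (- \<bar>x - y\<bar>) * \<bar>CH_source (u t) y\<bar> \<le> (?A * exp (- x)) * exp (- ?k * \<bar>y - 0\<bar>)" for y
  proof -
    have "exp (- \<bar>x - y\<bar>) \<le> exp (- x) * exp y" by (simp add: exp_add[symmetric])
    then have "exp (- \<bar>x - y\<bar>) * \<bar>CH_source (u t) y\<bar> \<le> exp (- x) * exp y * \<bar>CH_source (u t) y\<bar>"
      by (rule mult_right_mono) simp
    also have "\<dots> = exp (- x) * (exp y * \<bar>CH_source (u t) y\<bar>)" by simp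
    also have "\<dots> \<le> exp (- x) * (?A * exp (- ?k * \<bar>y\<bar>))"
    proof (rule mult_left_mono)
      show "exp y * \<bar>CH_source (u t) y\<bar> \<le> ?A * exp (- ?k * \<bar>y\<bar>)"
      proof (cases "0 \<le> y")
        case True
        have "\<bar>CH_source (u t) y\<bar> \<le> 2 * ((L * exp (- \<alpha> * y)) * (L * exp (- \<alpha> * y)))"
          by (intro CH_source_bound decay t)
        then have "exp y * \<bar>CH_source (u t) y\<bar> \<le> exp y * (2 * ((L * exp (- \<alpha> * y)) * (L * exp (- \<alpha> * y))))"
          by (rule mult_left_mono) simp
        also have "\<dots> = 2 * (L * L) * (exp y * (exp (- \<alpha> * y) * exp (- \<alpha> * y)))" by (simp only: mult_ac)
        also have "exp y * (exp (- \<alpha> * y) * exp (- \<alpha> * y)) = exp (- ?k * \<bar>y\<bar>)"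
          unfolding exp_add[symmetric] using True by (simp add: algebra_simps)
        also have "2 * (L * L) * exp (- ?k * \<bar>y\<bar>) \<le> ?A * exp (- ?k * \<bar>y\<bar>)"
          by (intro mult_right_mono) auto
        finally show ?thesis .
      next
        case False
        have "\<bar>CH_source (u t) y\<bar> \<le> 2 * (M * M)"
          by (intro CH_source_bound u_bound ux_bound t)
        then have "exp y * \<bar>CH_source (u t) y\<bar> \<le> exp y * (2 * (M * M))"
          by (rule mult_left_mono) simp
        also have "\<dots> \<le> exp (- ?k * \<bar>y\<bar>) * ?A"
        proof (rule mult_mono)
          have "1 * y \<le> ?k * y" using False \<alpha> by (intro mult_right_mono_neg) auto
          moreover have "- ?k * \<bar>y\<bar> = ?k * y" using False by (simp add: algebra_simps)
          ultimately show "exp y \<le> exp (- ?k * \<bar>y\<bar>)" by simp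
        qed simp_all
        finally show ?thesis by (simp only: mult.commute)
      qed
    qed simp
    finally show ?thesis by (simp only: mult_ac diff_0_right)
  qed
  from convolution_deriv_G_bound(2)[OF k source_measurable[OF t] this]
  show ?thesis by simp
qed

text \<open>
  At rate $1$ the weight is no longer preserved by the convolution, but the bound on the nonlocal term
  is already known and enters as a fixed source.
\<close>
lemma decay_exponent_one:
  assumes \<alpha>: "1 / 2 < \<alpha>" "\<alpha> < 1"
    and decay: "\<And>t x. t \<in> {0..T} \<Longrightarrow> \<bar>u t x\<bar> \<le> L * exp (- \<alpha> * x)"
      "\<And>t x. t \<in> {0..T} \<Longrightarrow> \<bar>deriv (u t) x\<bar> \<le> L * exp (- \<alpha> * x)"
    and init: "0 \<le> C" "\<And>x. \<bar>u 0 x\<bar> \<le> C * exp (- x)"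
  obtains B where "0 \<le> B" "\<And>t x. t \<in> {0..T} \<Longrightarrow> \<bar>u t x\<bar> \<le> B * exp (- x)"
proof -
  define r where "r = 2 * (M * M + L * L) / (2 * \<alpha> - 1)"
  have r: "0 \<le> r" using \<alpha> unfolding r_def by (intro divide_nonneg_pos) auto
  define B where "B = max C r"
  have B: "0 \<le> B" using init(1) by (simp add: B_def)
  let ?K = "M + 1"
  have K0: "0 \<le> ?K" using M by simp
  have weighted: "\<bar>u t x\<bar> \<le> B * (exp (?K * t) * two_sided_weight 1 \<delta> x)"
    if t: "t \<in> {0..T}" and \<delta>: "0 < \<delta>" for t x \<delta>
  proof (rule transport_maximum_principle[where w = u and a = u and M = M and c = 0 and r = r and \<theta> = 1,
        OF zero_less_one order_refl \<delta> K0 u_continuous u_bound u_t u_x u_bound])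
    fix t x assume t: "t \<in> {0..T}"
    have "\<bar>nonlocal t x\<bar> \<le> r * exp (- x)"
      unfolding r_def by (rule nonlocal_decay[OF \<alpha> decay t])
    also have "\<dots> \<le> r * (exp (?K * t) * two_sided_weight 1 \<delta> x)"
    proof (intro mult_left_mono r)
      have "1 * exp (- 1 * x) \<le> exp (?K * t) * two_sided_weight 1 \<delta> x"
        using K0 t \<delta> by (intro mult_mono exp_le_two_sided_weight) auto
      then show "exp (- x) \<le> exp (?K * t) * two_sided_weight 1 \<delta> x" by simp
    qed
    finally show "\<bar>- (u t x * deriv (u t) x) - nonlocal t x + u t x * deriv (u t) x\<bar>
        \<le> 0 * \<bar>u t x\<bar> + r * (exp (?K * t) * two_sided_weight 1 \<delta> x)"
      by simp
  next
    fix x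
    have "\<bar>u 0 x\<bar> \<le> C * exp (- 1 * x)" using init(2)[of x] by simp
    also have "\<dots> \<le> B * two_sided_weight 1 \<delta> x"
      using \<delta> B by (intro mult_mono exp_le_two_sided_weight) (auto simp: B_def)
    finally show "\<bar>u 0 x\<bar> \<le> B * two_sided_weight 1 \<delta> x" .
  qed (use t in \<open>simp_all add: B_def\<close>)
  show thesis
  proof (rule that)
    show "0 \<le> B * exp (?K * T)" using B by simp
    fix t x assume t: "t \<in> {0..T}"
    have expand: "B * (exp (?K * t) * two_sided_weight 1 \<delta> x)
        = B * exp (?K * t) * exp (- x) + \<delta> * (B * exp (?K * t) * exp x)" for \<delta>
      unfolding two_sided_weight_def by (simp add: distrib_left mult_ac)
    have "\<bar>u t x\<bar> \<le> B * exp (?K * t) * exp (- x)"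
      by (rule le_of_le_perturbation) (rule weighted[OF t, where x = x, unfolded expand])
    also have "\<dots> \<le> B * exp (?K * T) * exp (- x)"
      using B K0 t by (intro mult_right_mono mult_left_mono) (auto intro!: mult_left_mono)
    finally show "\<bar>u t x\<bar> \<le> B * exp (?K * T) * exp (- x)" .
  qed
qed

end

theorem theorem1p3:
  fixes T s \<alpha> :: real and u :: "real \<Rightarrow> real \<Rightarrow> real"
  assumes "T > 0" and "s > 3/2"
    and "CH_strong_solution s T u"
    and "1/2 < \<alpha>" and "\<alpha> < 1"
    and "u 0 \<in> O[at_top](\<lambda>x. exp (- x))"
    and "deriv (u 0) \<in> O[at_top](\<lambda>x. exp (- \<alpha> * x))"
  shows "\<exists>C>0. \<exists>X>0. \<forall>x\<ge>X. \<forall>t\<in>{0..T}. \<bar>u t x\<bar> \<le> C * exp (- x)"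
proof -
  have T: "0 \<le> T" using assms(1) by simp
  note sob = strong_solution_space(1)[OF assms(3)] and cont = strong_solution_space(2)[OF assms(3)]
  obtain M0 where M0: "\<And>t x. t \<in> {0..T} \<Longrightarrow> \<bar>u t x\<bar> \<le> M0"
    "\<And>t x. t \<in> {0..T} \<Longrightarrow> \<bar>deriv (u t) x\<bar> \<le> M0"
    by (rule strong_solution_bounded[OF assms(3,2) T]) blast
  interpret CH_classical_solution T "max 1 M0" u
    by unfold_locales
      (use T M0 sobolev_C1(1,2)[OF assms(2) sob cont] strong_solution_jointly_continuous[OF assms(3,2)]
        strong_solution_time_derivative[OF assms(3,2)] in \<open>auto simp: le_max_iff_disj\<close>)
  have T0: "0 \<in> {0..T}" using T by simp
  have "u 0 \<in> O[at_top](\<lambda>x. exp (- 1 * x))" using assms(6) by simp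
  then obtain C1 where C1: "0 \<le> C1" "\<And>x. \<bar>u 0 x\<bar> \<le> C1 * exp (- 1 * x)"
    by (rule bigo_exp_imp_global_bound[OF _ zero_le_one u_bound[OF T0]]) blast
  have \<alpha>0: "0 < \<alpha>" using assms(4) by simp
  obtain C2 where C2: "0 \<le> C2" "\<And>x. \<bar>deriv (u 0) x\<bar> \<le> C2 * exp (- \<alpha> * x)"
    by (rule bigo_exp_imp_global_bound[OF assms(7) less_imp_le[OF \<alpha>0] ux_bound[OF T0]]) blast
  define C where "C = max (max 1 M0) (max C1 C2)"
  have "\<bar>u 0 x\<bar> \<le> C * exp (- \<alpha> * x)" for x
  proof (cases "0 \<le> x")
    case True
    have "\<alpha> * x \<le> 1 * x" using True assms(5) by (intro mult_right_mono) auto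
    then have "C1 * exp (- 1 * x) \<le> C * exp (- \<alpha> * x)"
      using C1(1) by (intro mult_mono) (auto simp: C_def)
    then show ?thesis using C1(2)[of x] by linarith
  next
    case False
    have "1 \<le> exp (- \<alpha> * x)" using False \<alpha>0 by (simp add: mult_nonneg_nonpos)
    then have "max 1 M0 * 1 \<le> C * exp (- \<alpha> * x)" by (intro mult_mono) (auto simp: C_def)
    then show ?thesis using u_bound[OF T0, of x] by linarith
  qed
  moreover have "\<bar>deriv (u 0) x\<bar> \<le> C * exp (- \<alpha> * x)" for x
  proof -
    have "C2 * exp (- \<alpha> * x) \<le> C * exp (- \<alpha> * x)" by (intro mult_right_mono) (auto simp: C_def)
    then show ?thesis using C2(2)[of x] by linarith
  qed
  ultimately obtain L where L: "\<And>t x. t \<in> {0..T} \<Longrightarrow> \<bar>u t x\<bar> \<le> L * exp (- \<alpha> * x)"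
    "\<And>t x. t \<in> {0..T} \<Longrightarrow> \<bar>deriv (u t) x\<bar> \<le> L * exp (- \<alpha> * x)"
    using decay_below_one[OF \<alpha>0 assms(5)] by blast
  have "\<bar>u 0 x\<bar> \<le> C1 * exp (- x)" for x using C1(2)[of x] by simp
  then obtain B where B: "0 \<le> B" "\<And>t x. t \<in> {0..T} \<Longrightarrow> \<bar>u t x\<bar> \<le> B * exp (- x)"
    using decay_exponent_one[OF assms(4,5) L C1(1)] by blast
  have "\<bar>u t x\<bar> \<le> (B + 1) * exp (- x)" if "t \<in> {0..T}" for t x
    using B(2)[OF that, of x] by (simp add: distrib_right add_increasing2)
  then show ?thesis
    using B(1) by (intro exI[of _ "B + 1"] exI[of _ 1] conjI allI impI ballI) auto
qed

end
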